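(* Let $G=M\bowtie_\gamma H$ be the cocycle double cross product of a cocycle matched pair $(M,H)$, with Lie algebra $T_oM\bowtie_\theta\mathfrak h$. Given a (reduced) Hamiltonian $\mathfrak H=\mathfrak H(\kappa,\lambda)$ on $T_o^*M\oplus\mathfrak h^*$, the Lie-Poisson equations are given by $$\frac{d\kappa}{dt}=\mathfrak{ad}^*_{\frac{\delta\mathfrak H}{\delta\kappa}}(\kappa)-\kappa\overset{*}{\triangleleft}\Big(\frac{\delta\mathfrak H}{\delta\lambda}\Big)-\mathfrak a^*_{\frac{\delta\mathfrak H}{\delta\lambda}}(\lambda)-\theta^*_{\frac{\delta\mathfrak H}{\delta\kappa}}(\lambda),$$ $$\frac{d\lambda}{dt}=\mathrm{ad}^*_{\frac{\delta\mathfrak H}{\delta\lambda}}\lambda+\mathfrak b^*_{\frac{\delta\mathfrak H}{\delta\kappa}}(\kappa)+{}_{\frac{\delta\mathfrak H}{\delta\kappa}}\psi^*(\lambda).$$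
   Context: Cocycle matched pair. $M$ is a smooth manifold with a distinguished element $o$, $H$ is a Lie group (product $*$, identity $1$, Lie algebra $\mathfrak h$) with a smooth left action $H\times M\to M$, $(h,m)\mapsto h\triangleright m$, satisfying $h\triangleright o=o$. There are smooth maps $\sigma:H\times M\to H$, $\Phi:M\times M\to M$ (written $m_1\cdot m_2$), $\gamma:M\times M\to H$ with $\sigma(h,o)=h$, $\sigma(1,m)=1$, $\gamma(o,o)=1$, and (i) $o\cdot m=m=m\cdot o$; (ii) $\gamma(m,o)=1=\gamma(o,m)$; (iii) $h\triangleright(m_1\cdot m_2)=(h\triangleright m_1)\cdot(\sigma(h,m_1)\triangleright m_2)$; (iv) $\sigma(h,m_1\cdot m_2)*\gamma(m_1,m_2)=\gamma(h\triangleright m_1,\sigma(h,m_1)\triangleright m_2)*\sigma(\sigma(h,m_1),m_2)$; (v) $\sigma(h_1*h_2,m)=\sigma(h_1,h_2\triangleright m)*\sigma(h_2,m)$; (vi) $m_1\cdot(m_2\cdot m_3)=(m_1\cdot m_2)\cdot(\gamma(m_1,m_2)\triangleright m_3)$; (vii) $\gamma(m_1,m_2\cdot m_3)*\gamma(m_2,m_3)=\gamma(m_1\cdot m_2,\gamma(m_1,m_2)\triangleright m_3)*\sigma(\gamma(m_1,m_2),m_3)$; (viii) for each $m\in M$ there is $m^r\in M$ with $m\cdot m^r=o$. Then (known) $M\bowtie_\gamma H:=M\times H$ is a Lie group with identity $(o,1)$ and product $$(m_1,h_1)(m_2,h_2)=\big(m_1\cdot(h_1\triangleright m_2),\ \gamma(m_1,h_1\triangleright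 m_2)*\sigma(h_1,m_2)*h_2\big),$$ called the cocycle double cross product. Lie algebra. The Lie algebra of $G=M\bowtie_\gamma H$ is $T_oM\oplus\mathfrak h$ as a vector space, with $\mathfrak h$ a subalgebra; it is denoted $T_oM\bowtie_\theta\mathfrak h$, and its dual is $T_o^*M\oplus\mathfrak h^*$. Define bilinear maps by decomposing brackets into components in $T_oM$ and $\mathfrak h$: $[\eta,v]=\eta\triangleright v+\psi(\eta,v)$ and $[v_1,v_2]=[[v_1,v_2]]+\theta(v_1,v_2)$ for $v,v_1,v_2\in T_oM$, $\eta\in\mathfrak h$. Thus $$[(v_1,\eta_1),(v_2,\eta_2)]=\big([[v_1,v_2]]+\eta_1\triangleright v_2-\eta_2\triangleright v_1,\ [\eta_1,\eta_2]+\psi(\eta_1,v_2)-\psi(\eta_2,v_1)+\theta(v_1,v_2)\big).$$ Maps. For $\alpha\in T_o^*M$: $\langle\alpha\overset{*}{\triangleleft}\eta,w\rangle=\langle\alpha,\eta\triangleright w\rangle$. The linear maps $\mathfrak a_\eta:T_oM\to\mathfrak h$, $v\mapsto\psi(\eta,v)$; $\mathfrak b_v:\mathfrak h\to T_oM$, $\eta\mapsto\eta\triangleright v$; ${}_v\psi:\mathfrak h\to\mathfrak h$, $\eta\mapsto\psi(\eta,v)$; $\theta_v:T_oM\to\mathfrak h$, $w\mapsto\theta(v,w)$ have transposes $\mathfrak a_\eta^*,\mathfrak b_v^*,{}_v\psi^*,\theta_v^*$ (no sign). In contrast $\langle\mathfrak{ad}^*_v\alpha,w\rangle=-\langle\alpha,[[v,w]]\rangle$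 and, for any Lie algebra, $\langle\mathrm{ad}^*_\xi\mu,\zeta\rangle=-\langle\mu,[\xi,\zeta]\rangle$. Lie-Poisson equations. For a Lie algebra $\mathfrak g$ and $\mathfrak H=\mathfrak H(\mu)$ on $\mathfrak g^*$ these are $\frac{d\mu}{dt}=\mathrm{ad}^*_{\frac{\delta\mathfrak H}{\delta\mu}}(\mu)$, with $\delta\mathfrak H/\delta\mu\in\mathfrak g$ the derivative of $\mathfrak H$. In the claim $\mu=(\kappa,\lambda)$, $\delta\mathfrak H/\delta\kappa\in T_oM$, $\delta\mathfrak H/\delta\lambda\in\mathfrak h$. *)

theory Defs
  imports "HOL-Analysis.Analysis" "HOL-Algebra.Group_Action"
begin

section \<open>Finite-dimensional model spaces\<close>

text \<open>Unlike \<^class>\<open>euclidean_space\<close>, this class does not exclude dimension 0, so that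
  zero-dimensional manifolds (for instance discrete Lie groups) are covered.\<close>

class finite_dim_inner = real_inner +
  assumes finite_dim: "\<exists>B. finite B \<and> (\<forall>x. \<exists>c. x = (\<Sum>b\<in>B. scaleR (c b) b))"

lemma finite_dim_span: "\<exists>B::'a::finite_dim_inner set. finite B \<and> span B = UNIV"
proof -
  obtain B :: "'a set" where B: "finite B" "\<And>x. \<exists>c. x = (\<Sum>b\<in>B. c b *\<^sub>R b)"
    using finite_dim[where 'a = 'a] by blast
  then have "span B = UNIV" using span_finite[OF B(1)] by blast
  with B show ?thesis by blast
qed

instance euclidean_space \<subseteq> finite_dim_inner
  by standard (metis finite_Basis euclidean_representation)

instance prod :: (finite_dim_inner, finite_dim_inner) finite_dim_inner
proof
  obtain A :: "'a set" and B :: "'b set"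
    where A: "finite A" "span A = UNIV" and B: "finite B" "span B = UNIV"
    using finite_dim_span[where 'a = 'a] finite_dim_span[where 'a = 'b] by blast
  have "span (A \<times> {0} \<union> {0} \<times> B) = (UNIV :: ('a \<times> 'b) set)" (is "span ?C = _")
  proof -
    have l: "(a, 0) \<in> span ?C" for a
    proof -
      have "a \<in> span A" using A by simp
      then show ?thesis
      proof (induction rule: span_induct_alt)
        case base
        then show ?case by (metis span_zero zero_prod_def)
      next
        case (step c x y)
        have "(x, 0) \<in> span ?C" using step by (intro span_base) auto
        then have "c *\<^sub>R (x, 0) + (y, 0) \<in> span ?C"
          using step by (intro span_add span_scale)
        then show ?case by simp
      qed
    qed
    have r: "(0, b) \<in> span ?C" for b
    proof -
      have "b \<in> span B" using B by simp
      then show ?thesis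
      proof (induction rule: span_induct_alt)
        case base
        then show ?case by (metis span_zero zero_prod_def)
      next
        case (step c x y)
        have "(0, x) \<in> span ?C" using step by (intro span_base) auto
        then have "c *\<^sub>R (0, x) + (0, y) \<in> span ?C"
          using step by (intro span_add span_scale)
        then show ?case by simp
      qed
    qed
    have "p \<in> span ?C" for p
      using span_add[OF l[of "fst p"] r[of "snd p"]] by simp
    then show ?thesis by blast
  qed
  moreover have "finite ?C" using A B by simp
  ultimately show "\<exists>B::('a \<times> 'b) set. finite B \<and> (\<forall>x. \<exists>c. x = (\<Sum>b\<in>B. c b *\<^sub>R b))"
    using span_finite[of ?C] by (intro exI[of _ ?C]) auto
qed

section \<open>Smooth manifolds and smooth maps\<close>

text \<open>On an open subset of a finite-dimensional space, \<open>Ck_on k S f\<close> says that \<open>f\<close> is \<open>k\<close> times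
  continuously differentiable: all iterated directional derivatives exist and are continuous.\<close>

primrec Ck_on :: "nat \<Rightarrow> 'a::real_normed_vector set \<Rightarrow> ('a \<Rightarrow> 'b::real_normed_vector) \<Rightarrow> bool"
  where
    "Ck_on 0 S f \<longleftrightarrow> continuous_on S f"
  | "Ck_on (Suc k) S f \<longleftrightarrow>
       (\<forall>x\<in>S. f differentiable (at x)) \<and>
       (\<forall>v. Ck_on k S (\<lambda>x. frechet_derivative f (at x) v))"

definition smooth_on :: "'a::real_normed_vector set \<Rightarrow> ('a \<Rightarrow> 'b::real_normed_vector) \<Rightarrow> bool"
  where "smooth_on S f \<longleftrightarrow> (\<forall>k. Ck_on k S f)"

text \<open>A chart is a pair of its domain and its coordinate map; the value of the coordinate map
  outside the domain is irrelevant.\<close>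

type_synonym ('p, 'a) chart = "'p set \<times> ('p \<Rightarrow> 'a)"

definition is_chart :: "('p::topological_space, 'a::real_normed_vector) chart \<Rightarrow> bool"
  where "is_chart c \<longleftrightarrow> open (fst c) \<and> open (snd c ` fst c) \<and>
    (\<exists>g. homeomorphism (fst c) (snd c ` fst c) (snd c) g)"

definition chart_inv :: "('p, 'a) chart \<Rightarrow> 'a \<Rightarrow> 'p"
  where "chart_inv c = inv_into (fst c) (snd c)"

text \<open>The atlas need not be maximal, but may be. The points of the manifold are the elements
  of the type \<open>'p\<close>.\<close>

definition smooth_atlas :: "('p::topological_space, 'a::real_normed_vector) chart set \<Rightarrow> bool"
  where "smooth_atlas A \<longleftrightarrow> (\<forall>c\<in>A. is_chart c) \<and> \<Union>(fst ` A) = UNIV \<and>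
    (\<forall>c\<in>A. \<forall>d\<in>A. smooth_on (snd c ` (fst c \<inter> fst d)) (snd d \<circ> chart_inv c))"

definition smooth_map ::
  "('p::topological_space, 'a::real_normed_vector) chart set \<Rightarrow>
   ('q::topological_space, 'b::real_normed_vector) chart set \<Rightarrow> ('p \<Rightarrow> 'q) \<Rightarrow> bool"
  where "smooth_map A B f \<longleftrightarrow> continuous_on UNIV f \<and>
    (\<forall>c\<in>A. \<forall>d\<in>B. smooth_on (snd c ` (fst c \<inter> f -` fst d)) (snd d \<circ> f \<circ> chart_inv c))"

definition prod_chart :: "('p, 'a) chart \<Rightarrow> ('q, 'b) chart \<Rightarrow> ('p \<times> 'q, 'a \<times> 'b) chart"
  where "prod_chart c d = (fst c \<times> fst d, map_prod (snd c) (snd d))"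

definition prod_atlas ::
  "('p, 'a) chart set \<Rightarrow> ('q, 'b) chart set \<Rightarrow> ('p \<times> 'q, 'a \<times> 'b) chart set"
  where "prod_atlas A B = (\<lambda>(c, d). prod_chart c d) ` (A \<times> B)"

section \<open>Lie groups and their Lie algebras\<close>

definition lie_group ::
  "('h::topological_space, 'a::real_normed_vector) chart set \<Rightarrow> 'h monoid \<Rightarrow> bool"
  where "lie_group A G \<longleftrightarrow> smooth_atlas A \<and> group G \<and> carrier G = UNIV \<and>
    smooth_map (prod_atlas A A) A (\<lambda>(x, y). x \<otimes>\<^bsub>G\<^esub> y) \<and>
    smooth_map A A (\<lambda>x. inv\<^bsub>G\<^esub> x)"

text \<open>A chart \<open>c\<close> around a point \<open>p\<close> identifies the tangent space at \<open>p\<close> with the model space of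
  the manifold. The following is the coordinate expression, in a chart \<open>c\<close> around the
  identity, of the left-invariant vector field \<open>g \<mapsto> T\<^sub>1L\<^sub>g \<xi>\<close>; the Lie bracket is the value at the
  identity of the commutator of left-invariant vector fields, where in coordinates
  \<open>[X, Y] = DY \<sqdot> X - DX \<sqdot> Y\<close>.\<close>

definition left_invariant_field ::
  "('h, 'a::real_normed_vector) chart \<Rightarrow> 'h monoid \<Rightarrow> 'a \<Rightarrow> 'a \<Rightarrow> 'a"
  where "left_invariant_field c G \<xi> x =
    frechet_derivative (\<lambda>y. snd c (chart_inv c x \<otimes>\<^bsub>G\<^esub> chart_inv c y)) (at (snd c \<one>\<^bsub>G\<^esub>)) \<xi>"

definition lie_bracket ::
  "('h, 'a::real_normed_vector) chart \<Rightarrow> 'h monoid \<Rightarrow> 'a \<Rightarrow> 'a \<Rightarrow> 'a"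
  where "lie_bracket c G \<xi> \<eta> =
    (let e = snd c \<one>\<^bsub>G\<^esub>; X = left_invariant_field c G \<xi>; Y = left_invariant_field c G \<eta>
     in frechet_derivative Y (at e) (X e) - frechet_derivative X (at e) (Y e))"

section \<open>Cocycle matched pairs\<close>

locale cocycle_matched_pair =
  fixes AM :: "('m::{t2_space, second_countable_topology}, 'v::finite_dim_inner) chart set"
    and pt :: 'm
    and AH :: "('h::{t2_space, second_countable_topology}, 'g::finite_dim_inner) chart set"
    and H :: "'h monoid" (structure)
    and act :: "'h \<Rightarrow> 'm \<Rightarrow> 'm"
    and \<sigma> :: "'h \<Rightarrow> 'm \<Rightarrow> 'h"
    and \<Phi> :: "'m \<Rightarrow> 'm \<Rightarrow> 'm"
    and \<gamma> :: "'m \<Rightarrow> 'm \<Rightarrow> 'h"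
  assumes manifold: "smooth_atlas AM"
    and lie_group: "lie_group AH H"
    and action: "group_action H UNIV act"
    and smooth_act: "smooth_map (prod_atlas AH AM) AM (\<lambda>(h, m). act h m)"
    and act_pt: "act h pt = pt"
    and smooth_sigma: "smooth_map (prod_atlas AH AM) AH (\<lambda>(h, m). \<sigma> h m)"
    and smooth_Phi: "smooth_map (prod_atlas AM AM) AM (\<lambda>(m, n). \<Phi> m n)"
    and smooth_gamma: "smooth_map (prod_atlas AM AM) AH (\<lambda>(m, n). \<gamma> m n)"
    and sigma_pt: "\<sigma> h pt = h"
    and sigma_one: "\<sigma> \<one> m = \<one>"
    and gamma_pt_pt: "\<gamma> pt pt = \<one>"
    and Phi_unit: "\<Phi> pt m = m" "\<Phi> m pt = m"
    and gamma_unit: "\<gamma> m pt = \<one>" "\<gamma> pt m = \<one>"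
    and act_Phi: "act h (\<Phi> m1 m2) = \<Phi> (act h m1) (act (\<sigma> h m1) m2)"
    and sigma_Phi:
      "\<sigma> h (\<Phi> m1 m2) \<otimes> \<gamma> m1 m2 = \<gamma> (act h m1) (act (\<sigma> h m1) m2) \<otimes> \<sigma> (\<sigma> h m1) m2"
    and sigma_mult: "\<sigma> (h1 \<otimes> h2) m = \<sigma> h1 (act h2 m) \<otimes> \<sigma> h2 m"
    and Phi_assoc: "\<Phi> m1 (\<Phi> m2 m3) = \<Phi> (\<Phi> m1 m2) (act (\<gamma> m1 m2) m3)"
    and gamma_cocycle:
      "\<gamma> m1 (\<Phi> m2 m3) \<otimes> \<gamma> m2 m3 = \<gamma> (\<Phi> m1 m2) (act (\<gamma> m1 m2) m3) \<otimes> \<sigma> (\<gamma> m1 m2) m3"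
    and right_inverse: "\<exists>mr. \<Phi> m mr = pt"

definition cocycle_double_cross_product ::
  "'m \<Rightarrow> 'h monoid \<Rightarrow> ('h \<Rightarrow> 'm \<Rightarrow> 'm) \<Rightarrow> ('h \<Rightarrow> 'm \<Rightarrow> 'h) \<Rightarrow> ('m \<Rightarrow> 'm \<Rightarrow> 'm) \<Rightarrow>
   ('m \<Rightarrow> 'm \<Rightarrow> 'h) \<Rightarrow> ('m \<times> 'h) monoid"
  where "cocycle_double_cross_product pt H act \<sigma> \<Phi> \<gamma> =
    \<lparr>carrier = UNIV,
     mult = (\<lambda>(m1, h1) (m2, h2).
       (\<Phi> m1 (act h1 m2), \<gamma> m1 (act h1 m2) \<otimes>\<^bsub>H\<^esub> \<sigma> h1 m2 \<otimes>\<^bsub>H\<^esub> h2)),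
     one = (pt, \<one>\<^bsub>H\<^esub>)\<rparr>"

text \<open>The components of a bracket \<open>br\<close> on \<open>'v \<times> 'g\<close>:
  \<open>[\<eta>, v] = \<eta> \<triangleright> v + \<psi>(\<eta>, v)\<close> and \<open>[v, w] = [[v, w]] + \<theta>(v, w)\<close>.\<close>

definition inf_act :: "('v::zero \<times> 'g::zero \<Rightarrow> 'v \<times> 'g \<Rightarrow> 'v \<times> 'g) \<Rightarrow> 'g \<Rightarrow> 'v \<Rightarrow> 'v"
  where "inf_act br \<eta> v = fst (br (0, \<eta>) (v, 0))"

definition inf_psi :: "('v::zero \<times> 'g::zero \<Rightarrow> 'v \<times> 'g \<Rightarrow> 'v \<times> 'g) \<Rightarrow> 'g \<Rightarrow> 'v \<Rightarrow> 'g"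
  where "inf_psi br \<eta> v = snd (br (0, \<eta>) (v, 0))"

definition inf_bracket :: "('v::zero \<times> 'g::zero \<Rightarrow> 'v \<times> 'g \<Rightarrow> 'v \<times> 'g) \<Rightarrow> 'v \<Rightarrow> 'v \<Rightarrow> 'v"
  where "inf_bracket br v w = fst (br (v, 0) (w, 0))"

definition inf_theta :: "('v::zero \<times> 'g::zero \<Rightarrow> 'v \<times> 'g \<Rightarrow> 'v \<times> 'g) \<Rightarrow> 'v \<Rightarrow> 'v \<Rightarrow> 'g"
  where "inf_theta br v w = snd (br (v, 0) (w, 0))"

section \<open>Lie-Poisson equations\<close>

text \<open>The dual of a finite-dimensional space \<open>'a\<close> is \<^typ>\<open>'a \<Rightarrow>\<^sub>L real\<close>. The transpose is
  meaningful for linear \<open>f\<close> between finite-dimensional spaces, which are automatically bounded.\<close>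

definition transpose_map ::
  "('a::real_normed_vector \<Rightarrow> 'b::real_normed_vector) \<Rightarrow> ('b \<Rightarrow>\<^sub>L real) \<Rightarrow> ('a \<Rightarrow>\<^sub>L real)"
  where "transpose_map f \<alpha> = Blinfun (\<lambda>x. blinfun_apply \<alpha> (f x))"

definition coad ::
  "('a::real_normed_vector \<Rightarrow> 'a \<Rightarrow> 'a) \<Rightarrow> 'a \<Rightarrow> ('a \<Rightarrow>\<^sub>L real) \<Rightarrow> ('a \<Rightarrow>\<^sub>L real)"
  where "coad br \<xi> \<mu> = Blinfun (\<lambda>\<zeta>. - blinfun_apply \<mu> (br \<xi> \<zeta>))"

text \<open>The derivative of \<open>F\<close> at \<open>\<mu>\<close>, an element of the bidual, viewed as a vector of \<open>'a\<close>.\<close>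

definition functional_derivative ::
  "(('a::real_normed_vector \<Rightarrow>\<^sub>L real) \<Rightarrow> real) \<Rightarrow> ('a \<Rightarrow>\<^sub>L real) \<Rightarrow> 'a"
  where "functional_derivative F \<mu> = (THE x. (F has_derivative (\<lambda>\<nu>. blinfun_apply \<nu> x)) (at \<mu>))"

definition lie_poisson_field ::
  "('a::real_normed_vector \<Rightarrow> 'a \<Rightarrow> 'a) \<Rightarrow> (('a \<Rightarrow>\<^sub>L real) \<Rightarrow> real) \<Rightarrow>
   ('a \<Rightarrow>\<^sub>L real) \<Rightarrow> ('a \<Rightarrow>\<^sub>L real)"
  where "lie_poisson_field br F \<mu> = coad br (functional_derivative F \<mu>) \<mu>"

text \<open>The identification of the dual of \<open>'v \<times> 'g\<close> with the sum of the duals.\<close>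

definition dual_split ::
  "(('v::real_normed_vector \<times> 'g::real_normed_vector) \<Rightarrow>\<^sub>L real) \<Rightarrow>
   ('v \<Rightarrow>\<^sub>L real) \<times> ('g \<Rightarrow>\<^sub>L real)"
  where "dual_split \<mu> = (transpose_map (\<lambda>v. (v, 0)) \<mu>, transpose_map (\<lambda>\<eta>. (0, \<eta>)) \<mu>)"

end

theory Submission
  imports Defs
begin

text \<open>The dual of \<open>T\<^sub>oM \<oplus> \<hh>\<close> splits as a direct sum of duals, and under this splitting
  \<open>\<delta>\<HH>/\<delta>\<mu> = (\<delta>\<HH>/\<delta>\<kappa>, \<delta>\<HH>/\<delta>\<lambda>)\<close> (lemma \<open>functional_derivative_dual_split\<close>). The Lie-Poisson
  equation is thus obtained by evaluating \<open>- \<langle>\<mu>, [(v, \<eta>), _]\<rangle>\<close> separately on \<open>(w, 0)\<close> and on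
  \<open>(0, \<zeta>)\<close> (lemma \<open>dual_split_coad\<close>). On \<open>(w, 0)\<close> the four components of the bracket appear with a
  minus sign; on \<open>(0, \<zeta>)\<close> the term \<open>[(v, 0), (0, \<zeta>)] = - [(0, \<zeta>), (v, 0)]\<close> gives the two positive
  transposes, and \<open>[(0, \<eta>), (0, \<zeta>)] = (0, [\<eta>, \<zeta>])\<close> gives the coadjoint action of \<open>\<hh>\<close>.

  This computation uses three properties of the bracket, which here is the commutator of left-invariant
  vector fields read in a chart: it is bilinear and continuous, it is antisymmetric, and it restricts to
  the bracket of \<open>\<hh>\<close>. Only antisymmetry is evident. For the other two, the multiplication of \<open>G\<close> read
  in a chart must be regular enough at the identity. If \<open>F\<close> is this coordinate expression, then
  \<open>X\<^sub>\<xi>(x) = D\<^sub>2F(x, e) \<xi>\<close>, so \<open>F\<close> has to be differentiable near \<open>(e, e)\<close>, with a derivative that is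
  itself differentiable at \<open>(e, e)\<close>. Smooth functions have this property, it is stable under composition
  (both are proved below), and the multiplication of \<open>G\<close> is composed of the smooth maps
  of the matched pair and of the multiplication of \<open>H\<close>, all of which preserve base points.
  That \<open>\<hh>\<close> is a subalgebra comes from \<open>(m, h)(o, k) = (m, h * k)\<close>: the left-invariant field of
  \<open>(0, \<eta>)\<close> on \<open>G\<close> is the one of \<open>\<eta>\<close> on \<open>H\<close>, extended by zero along \<open>M\<close>.\<close>

section \<open>Orthonormal bases\<close>

text \<open>Gram-Schmidt applied to a finite spanning set; the zero vector, which may occur in the result, has to be
  discarded before normalising.\<close>

lemma orthonormal_basis_exists:
  obtains B :: "'a::finite_dim_inner set"
  where "finite B" and "\<And>x. x = (\<Sum>b\<in>B. (x \<bullet> b) *\<^sub>R b)"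
proof -
  obtain B0 :: "'a set" where B0: "finite B0" "span B0 = UNIV"
    using finite_dim_span by blast
  obtain C where C: "finite C" "span C = (UNIV :: 'a set)" "pairwise orthogonal C"
    using basis_orthogonal[OF B0(1)] B0(2) by metis
  define B where "B = (\<lambda>c. c /\<^sub>R norm c) ` (C - {0})"
  have fin: "finite B" using C(1) by (simp add: B_def)
  have ortho: "b \<bullet> d = (if b = d then 1 else 0)" if bd: "b \<in> B" "d \<in> B" for b d
  proof -
    obtain c e where ce: "c \<in> C" "e \<in> C" "c \<noteq> 0" "e \<noteq> 0" "b = c /\<^sub>R norm c" "d = e /\<^sub>R norm e"
      using bd by (auto simp: B_def)
    show ?thesis
    proof (cases "c = e")
      case True
      then show ?thesis using ce by (simp add: dot_square_norm power2_eq_square field_simps)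
    next
      case False
      then have "b \<bullet> d = 0"
        using ce C(3) by (auto simp: pairwise_def orthogonal_def)
      moreover have "b \<bullet> b \<noteq> 0" using ce by simp
      ultimately show ?thesis by auto
    qed
  qed
  have "C \<subseteq> span B"
  proof
    fix c assume "c \<in> C"
    show "c \<in> span B"
    proof (cases "c = 0")
      case False
      with \<open>c \<in> C\<close> have "norm c *\<^sub>R (c /\<^sub>R norm c) \<in> span B"
        by (intro span_scale span_base) (auto simp: B_def)
      then show ?thesis using False by simp
    qed (simp add: span_zero)
  qed
  then have "span B = UNIV"
    using C(2) span_mono[of C "span B"] by (auto simp: span_span)
  then have "\<exists>u. x = (\<Sum>b\<in>B. u b *\<^sub>R b)" for x
    using span_finite[OF fin] by blast
  moreover have "x = (\<Sum>b\<in>B. (x \<bullet> b) *\<^sub>R b)" if "x = (\<Sum>b\<in>B. u b *\<^sub>R b)" for x u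
  proof -
    have "x \<bullet> d = u d" if "d \<in> B" for d
    proof -
      have "x \<bullet> d = (\<Sum>b\<in>B. if b = d then u b else 0)"
        using that ortho unfolding \<open>x = _\<close>
        by (auto simp: inner_sum_left intro!: sum.cong)
      then show ?thesis using that fin by simp
    qed
    then show ?thesis using that by (metis (no_types, lifting) sum.cong)
  qed
  ultimately show thesis using that[OF fin] by metis
qed

section \<open>Twice differentiability at a point\<close>

text \<open>The derivative is taken in the operator norm and exists on a neighbourhood, as a second derivative at
  \<open>p\<close> requires. Since \<open>f'\<close> is a map into a normed space, the product
  rule for a composition of derivatives becomes an instance of the rule for bounded bilinear maps.\<close>

definition twice_differentiable_at ::
  "('a::real_normed_vector \<Rightarrow> 'b::real_normed_vector) \<Rightarrow> 'a \<Rightarrow> bool"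
  where "twice_differentiable_at f p \<longleftrightarrow>
    (\<exists>f'. (\<forall>\<^sub>F x in nhds p. (f has_derivative blinfun_apply (f' x)) (at x)) \<and>
      f' differentiable (at p))"

lemma twice_differentiable_atI:
  assumes "\<forall>\<^sub>F x in nhds p. (f has_derivative blinfun_apply (f' x)) (at x)"
    and "f' differentiable (at p)"
  shows "twice_differentiable_at f p"
  using assms unfolding twice_differentiable_at_def by blast

lemma twice_differentiable_at_imp_tendsto:
  assumes "twice_differentiable_at f p"
  shows "filterlim f (nhds (f p)) (nhds p)"
proof -
  from assms have "\<exists>f'. (f has_derivative f') (at p)"
    unfolding twice_differentiable_at_def using eventually_nhds_x_imp_x by blast
  then have "isCont f p"
    using has_derivative_continuous by blast
  then show ?thesis
    by (simp add: isCont_def tendsto_at_iff_tendsto_nhds)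
qed

lemma twice_differentiable_at_cong:
  assumes "twice_differentiable_at f p" and "\<forall>\<^sub>F x in nhds p. f x = g x"
  shows "twice_differentiable_at g p"
proof -
  obtain f' where f': "\<forall>\<^sub>F x in nhds p. (f has_derivative blinfun_apply (f' x)) (at x)"
    "f' differentiable (at p)"
    using assms(1) unfolding twice_differentiable_at_def by blast
  have "\<forall>\<^sub>F x in nhds p. \<forall>\<^sub>F y in nhds x. f y = g y"
    using assms(2) by (simp add: eventually_eventually)
  with f'(1) have "\<forall>\<^sub>F x in nhds p. (g has_derivative blinfun_apply (f' x)) (at x)"
  proof eventually_elim
    case (elim x)
    have "\<forall>\<^sub>F y in at x. f y = g y"
      unfolding eventually_at_filter using elim(2) by (rule eventually_mono) simp
    then show ?case
      using elim eventually_nhds_x_imp_x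
      by (intro has_derivative_transform_eventually[OF elim(1)]) auto
  qed
  then show ?thesis using f'(2) by (rule twice_differentiable_atI)
qed

lemma twice_differentiable_at_bounded_linear:
  assumes "bounded_linear f"
  shows "twice_differentiable_at f p"
  unfolding twice_differentiable_at_def
  using assms
  by (intro exI[of _ "\<lambda>_. Blinfun f"])
    (auto simp: bounded_linear_Blinfun_apply bounded_linear_imp_has_derivative)

text \<open>The chain rule gives \<open>D(g \<circ> f)(x) = Dg(f x) \<circ> Df(x)\<close> for all \<open>x\<close> near \<open>p\<close>. The right-hand side is a
  continuous bilinear expression in two maps that are differentiable at \<open>p\<close>.\<close>

lemma twice_differentiable_at_compose:
  assumes f: "twice_differentiable_at f p" and g: "twice_differentiable_at g (f p)"
  shows "twice_differentiable_at (g \<circ> f) p"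
proof -
  obtain f' where f': "\<forall>\<^sub>F x in nhds p. (f has_derivative blinfun_apply (f' x)) (at x)"
    "f' differentiable (at p)"
    using f unfolding twice_differentiable_at_def by blast
  obtain g' where g': "\<forall>\<^sub>F y in nhds (f p). (g has_derivative blinfun_apply (g' y)) (at y)"
    "g' differentiable (at (f p))"
    using g unfolding twice_differentiable_at_def by blast
  have "\<forall>\<^sub>F x in nhds p. (g has_derivative blinfun_apply (g' (f x))) (at (f x))"
    using g'(1) twice_differentiable_at_imp_tendsto[OF f]
    by (rule eventually_compose_filterlim)
  with f'(1) have "\<forall>\<^sub>F x in nhds p.
      (g \<circ> f has_derivative blinfun_apply (g' (f x) o\<^sub>L f' x)) (at x)"
  proof eventually_elim
    case (elim x)
    show ?case
      using diff_chain_at[OF elim] by (simp add: o_def blinfun_compose.rep_eq)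
  qed
  moreover have "(\<lambda>x. g' (f x) o\<^sub>L f' x) differentiable (at p)"
  proof -
    have "f differentiable (at p)"
      using eventually_nhds_x_imp_x[OF f'(1)] by (rule differentiableI)
    then have "(g' \<circ> f) differentiable (at p)"
      using g'(2) by (intro differentiable_chain_at)
    then show ?thesis
      using f'(2) bounded_bilinear.FDERIV[OF bounded_bilinear_blinfun_compose]
      unfolding differentiable_def o_def by blast
  qed
  ultimately show ?thesis by (rule twice_differentiable_atI)
qed

lemma twice_differentiable_at_add:
  assumes "twice_differentiable_at f p" and "twice_differentiable_at g p"
  shows "twice_differentiable_at (\<lambda>x. f x + g x) p"
proof -
  obtain f' where f': "\<forall>\<^sub>F x in nhds p. (f has_derivative blinfun_apply (f' x)) (at x)"
    "f' differentiable (at p)"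
    using assms(1) unfolding twice_differentiable_at_def by blast
  obtain g' where g': "\<forall>\<^sub>F x in nhds p. (g has_derivative blinfun_apply (g' x)) (at x)"
    "g' differentiable (at p)"
    using assms(2) unfolding twice_differentiable_at_def by blast
  have "\<forall>\<^sub>F x in nhds p.
      ((\<lambda>x. f x + g x) has_derivative blinfun_apply (f' x + g' x)) (at x)"
    using f'(1) g'(1)
    by eventually_elim (auto simp: plus_blinfun.rep_eq intro: has_derivative_add)
  moreover have "(\<lambda>x. f' x + g' x) differentiable (at p)"
    using f'(2) g'(2) by (rule differentiable_add)
  ultimately show ?thesis by (rule twice_differentiable_atI)
qed

lemma bounded_linear_inl: "bounded_linear (\<lambda>x. (x, 0))"
  and bounded_linear_inr: "bounded_linear (\<lambda>y. (0, y))"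
  by (auto intro!: bounded_linear_Pair bounded_linear_ident bounded_linear_zero)

text \<open>A pair is the sum of the two components, each followed by a linear inclusion.\<close>

lemma twice_differentiable_at_Pair:
  assumes "twice_differentiable_at f p" and "twice_differentiable_at g p"
  shows "twice_differentiable_at (\<lambda>x. (f x, g x)) p"
  using twice_differentiable_at_add
    [OF twice_differentiable_at_compose
        [OF assms(1) twice_differentiable_at_bounded_linear[OF bounded_linear_inl]]
      twice_differentiable_at_compose
        [OF assms(2) twice_differentiable_at_bounded_linear[OF bounded_linear_inr]]]
  by (simp add: o_def)

text \<open>Smoothness controls each directional derivative \<open>x \<mapsto> Df(x) b\<close> separately. In finite dimension the
  operator \<open>Df(x)\<close> is a finite sum of rank-one operators \<open>v \<mapsto> (v \<bullet> b) Df(x) b\<close>, and each of them depends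
  linearly and continuously on the vector \<open>Df(x) b\<close>.\<close>

lemma smooth_on_imp_twice_differentiable_at:
  fixes f :: "'a::finite_dim_inner \<Rightarrow> 'b::real_normed_vector"
  assumes "smooth_on S f" and S: "\<forall>\<^sub>F x in nhds p. x \<in> S"
  shows "twice_differentiable_at f p"
proof -
  have "Ck_on 2 S f" using assms(1) by (simp add: smooth_on_def)
  then have d1: "\<And>x. x \<in> S \<Longrightarrow> (f has_derivative frechet_derivative f (at x)) (at x)"
    and d2: "\<And>x v. x \<in> S \<Longrightarrow> (\<lambda>x. frechet_derivative f (at x) v) differentiable (at x)"
    by (auto simp: numeral_2_eq_2 frechet_derivative_works[symmetric])
  obtain B :: "'a set" where B: "finite B" "\<And>x. x = (\<Sum>b\<in>B. (x \<bullet> b) *\<^sub>R b)"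
    using orthonormal_basis_exists by blast
  \<comment> \<open>the rank-one operator sending \<open>v\<close> to \<open>(v \<bullet> b) w\<close>\<close>
  define K :: "'a \<Rightarrow> 'b \<Rightarrow> 'a \<Rightarrow>\<^sub>L 'b"
    where "K b w = blinfun_scaleR_left w o\<^sub>L blinfun_inner_left b" for b w
  define f' where "f' x = (\<Sum>b\<in>B. K b (frechet_derivative f (at x) b))" for x
  have f': "blinfun_apply (f' x) = frechet_derivative f (at x)" if "x \<in> S" for x
  proof
    fix v
    interpret D: bounded_linear "frechet_derivative f (at x)"
      using d1[OF that] by (rule has_derivative_bounded_linear)
    have "blinfun_apply (f' x) v = (\<Sum>b\<in>B. (v \<bullet> b) *\<^sub>R frechet_derivative f (at x) b)"
      by (simp add: f'_def K_def blinfun.sum_left)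
    also have "\<dots> = frechet_derivative f (at x) (\<Sum>b\<in>B. (v \<bullet> b) *\<^sub>R b)"
      by (simp add: D.sum D.scaleR)
    finally show "blinfun_apply (f' x) v = frechet_derivative f (at x) v"
      using B(2)[of v] by simp
  qed
  have "\<forall>\<^sub>F x in nhds p. (f has_derivative blinfun_apply (f' x)) (at x)"
    using S by eventually_elim (simp add: f' d1)
  moreover have "f' differentiable (at p)"
  proof -
    have "p \<in> S" using S by (rule eventually_nhds_x_imp_x)
    have K: "bounded_linear (K b)" for b
      unfolding K_def
      by (rule bounded_linear_compose[OF bounded_bilinear.bounded_linear_left
            [OF bounded_bilinear_blinfun_compose] bounded_linear_blinfun_scaleR_left])
    have "(\<lambda>x. K b (frechet_derivative f (at x) b)) differentiable (at p)" for b
      using bounded_linear.has_derivative[OF K] d2[OF \<open>p \<in> S\<close>]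
      unfolding differentiable_def by blast
    then show ?thesis
      unfolding f'_def using B(1) by (intro differentiable_sum) auto
  qed
  ultimately show ?thesis by (rule twice_differentiable_atI)
qed

section \<open>Charts\<close>

lemma chart_inv_image:
  assumes "is_chart c" and "p \<in> fst c"
  shows "chart_inv c (snd c p) = p"
  using assms unfolding is_chart_def chart_inv_def homeomorphism_def
  by (metis inv_into_f_f inj_on_inverseI)

lemma eventually_in_chart_image:
  assumes "is_chart c" and "p \<in> fst c"
  shows "\<forall>\<^sub>F x in nhds (snd c p). x \<in> snd c ` fst c"
  using assms unfolding is_chart_def by (intro eventually_nhds_in_open) auto

lemma eventually_chart_inv_in_domain:
  assumes "is_chart c" and "p \<in> fst c"
  shows "\<forall>\<^sub>F x in nhds (snd c p). chart_inv c x \<in> fst c \<and> snd c (chart_inv c x) = x"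
  using eventually_in_chart_image[OF assms]
  by eventually_elim (auto simp: chart_inv_image[OF assms(1)])

lemma tendsto_chart_inv:
  assumes c: "is_chart c" and p: "p \<in> fst c"
  shows "filterlim (chart_inv c) (nhds p) (nhds (snd c p))"
proof -
  obtain g where g: "homeomorphism (fst c) (snd c ` fst c) (snd c) g"
    and op: "open (snd c ` fst c)"
    using c unfolding is_chart_def by blast
  have "g (snd c p) = p" using g p by (auto simp: homeomorphism_def)
  moreover have "continuous_on (snd c ` fst c) g" using g by (simp add: homeomorphism_def)
  ultimately have "filterlim g (nhds p) (at (snd c p))"
    using op p by (metis at_within_open continuous_on_def imageI)
  then have "filterlim g (nhds p) (nhds (snd c p))"
    using \<open>g (snd c p) = p\<close> tendsto_at_iff_tendsto_nhds by metis
  moreover have "\<forall>\<^sub>F x in nhds (snd c p). g x = chart_inv c x"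
    using eventually_in_chart_image[OF c p]
  proof eventually_elim
    case (elim x)
    then show ?case
      using g by (auto simp: homeomorphism_def chart_inv_image[OF c])
  qed
  ultimately show ?thesis
    using filterlim_cong by blast
qed

lemma is_chart_prod_chart:
  assumes "is_chart c" and "is_chart d"
  shows "is_chart (prod_chart c d)"
proof -
  obtain f where f: "homeomorphism (fst c) (snd c ` fst c) (snd c) f"
    using assms(1) unfolding is_chart_def by blast
  obtain g where g: "homeomorphism (fst d) (snd d ` fst d) (snd d) g"
    using assms(2) unfolding is_chart_def by blast
  have im: "map_prod (snd c) (snd d) ` (fst c \<times> fst d) = snd c ` fst c \<times> snd d ` fst d"
    by (rule map_prod_surj_on) auto
  have cont: "continuous_on (A \<times> B) (map_prod u v)"
    if "continuous_on A u" "continuous_on B v"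
    for A :: "'x::topological_space set" and B :: "'y::topological_space set"
      and u :: "'x \<Rightarrow> 'z::topological_space" and v :: "'y \<Rightarrow> 'w::topological_space"
    unfolding map_prod_def case_prod_beta
    using that
    by (intro continuous_on_Pair continuous_on_compose2[OF that(1)]
        continuous_on_compose2[OF that(2)] continuous_on_fst continuous_on_snd continuous_on_id) auto
  have imfg: "map_prod f g ` (snd c ` fst c \<times> snd d ` fst d) = fst c \<times> fst d"
    using f g by (intro map_prod_surj_on) (auto simp: homeomorphism_def)
  have "homeomorphism (fst c \<times> fst d) (snd c ` fst c \<times> snd d ` fst d)
      (map_prod (snd c) (snd d)) (map_prod f g)"
    unfolding homeomorphism_def im imfg
    using f g by (intro conjI cont) (auto simp: homeomorphism_def)
  moreover have "open (fst c \<times> fst d)" "open (snd c ` fst c \<times> snd d ` fst d)"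
    using assms unfolding is_chart_def by (simp_all add: open_Times)
  ultimately show ?thesis
    unfolding is_chart_def prod_chart_def fst_conv snd_conv im by blast
qed

lemma chart_inv_prod_chart:
  assumes "is_chart c" and "is_chart d" and "x \<in> snd c ` fst c" and "y \<in> snd d ` fst d"
  shows "chart_inv (prod_chart c d) (x, y) = (chart_inv c x, chart_inv d y)"
proof -
  obtain p q where "p \<in> fst c" "x = snd c p" "q \<in> fst d" "y = snd d q"
    using assms by auto
  then show ?thesis
    using chart_inv_image[OF is_chart_prod_chart[OF assms(1,2)], of "(p, q)"]
    by (simp add: prod_chart_def chart_inv_image assms)
qed

lemma eventually_chart_inv_prod_chart:
  assumes "is_chart c" and "is_chart d" and "p \<in> fst c" and "q \<in> fst d"
  shows "\<forall>\<^sub>F z in nhds (snd c p, snd d q).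
    chart_inv (prod_chart c d) z = (chart_inv c (fst z), chart_inv d (snd z))"
proof -
  have "\<forall>\<^sub>F z in nhds (snd c p, snd d q). fst z \<in> snd c ` fst c \<and> snd z \<in> snd d ` fst d"
    unfolding nhds_prod
    by (intro eventually_conj
        eventually_compose_filterlim[OF eventually_in_chart_image[OF assms(1,3)] filterlim_fst]
        eventually_compose_filterlim[OF eventually_in_chart_image[OF assms(2,4)] filterlim_snd])
  then show ?thesis
    by eventually_elim (auto simp: chart_inv_prod_chart[OF assms(1,2)] mem_Times_iff)
qed

text \<open>Both the source and the target chart contain the point in question, and \<open>f\<close> is continuous there, so that
  the coordinate expressions of two maps compose to the coordinate expression of their composition near
  the point.\<close>

definition twice_differentiable_in_charts ::
  "('p::topological_space, 'a::real_normed_vector) chart \<Rightarrow>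
   ('q::topological_space, 'b::real_normed_vector) chart \<Rightarrow> ('p \<Rightarrow> 'q) \<Rightarrow> 'p \<Rightarrow> bool"
  where "twice_differentiable_in_charts c d f p \<longleftrightarrow>
    is_chart c \<and> is_chart d \<and> p \<in> fst c \<and> f p \<in> fst d \<and>
    filterlim f (nhds (f p)) (nhds p) \<and>
    twice_differentiable_at (snd d \<circ> f \<circ> chart_inv c) (snd c p)"

text \<open>The coordinate expression is smooth on the set of points whose image lies in the target chart; by
  continuity of \<open>f\<close> this set contains a neighbourhood of \<open>p\<close>.\<close>

lemma smooth_map_imp_twice_differentiable_in_charts:
  fixes A :: "('p::topological_space, 'a::finite_dim_inner) chart set"
    and B :: "('q::topological_space, 'b::real_normed_vector) chart set"
  assumes f: "smooth_map A B f" and c: "c \<in> A" "is_chart c" "p \<in> fst c"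
    and d: "d \<in> B" "is_chart d" "f p \<in> fst d"
  shows "twice_differentiable_in_charts c d f p"
proof -
  have lim: "filterlim f (nhds (f p)) (nhds p)"
    using f unfolding smooth_map_def continuous_on_def
    by (metis UNIV_I tendsto_at_iff_tendsto_nhds)
  have "\<forall>\<^sub>F y in nhds (f p). y \<in> fst d"
    using d unfolding is_chart_def by (intro eventually_nhds_in_open) auto
  then have "\<forall>\<^sub>F q in nhds p. f q \<in> fst d"
    using lim by (rule eventually_compose_filterlim)
  then have "\<forall>\<^sub>F x in nhds (snd c p). f (chart_inv c x) \<in> fst d"
    using tendsto_chart_inv[OF c(2,3)] by (rule eventually_compose_filterlim)
  with eventually_chart_inv_in_domain[OF c(2,3)]
  have "\<forall>\<^sub>F x in nhds (snd c p). x \<in> snd c ` (fst c \<inter> f -` fst d)"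
    by eventually_elim force
  moreover have "smooth_on (snd c ` (fst c \<inter> f -` fst d)) (snd d \<circ> f \<circ> chart_inv c)"
    using f c d unfolding smooth_map_def by blast
  ultimately show ?thesis
    using smooth_on_imp_twice_differentiable_at c d lim
    unfolding twice_differentiable_in_charts_def by blast
qed

text \<open>The factor \<open>chart_inv d \<circ> snd d\<close> between the two coordinate expressions is the identity only on the
  domain of \<open>d\<close>, hence the equality of the coordinate expressions holds only near \<open>p\<close>.\<close>

lemma twice_differentiable_in_charts_compose:
  assumes f: "twice_differentiable_in_charts c d f p"
    and g: "twice_differentiable_in_charts d e g (f p)"
  shows "twice_differentiable_in_charts c e (\<lambda>x. g (f x)) p"
proof -
  have c: "is_chart c" "p \<in> fst c" and d: "is_chart d" "f p \<in> fst d"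
    and e: "is_chart e" "g (f p) \<in> fst e"
    and lim_f: "filterlim f (nhds (f p)) (nhds p)"
    and lim_g: "filterlim g (nhds (g (f p))) (nhds (f p))"
    and diff_f: "twice_differentiable_at (snd d \<circ> f \<circ> chart_inv c) (snd c p)"
    and diff_g: "twice_differentiable_at (snd e \<circ> g \<circ> chart_inv d) (snd d (f p))"
    using f g unfolding twice_differentiable_in_charts_def by simp_all
  have "\<forall>\<^sub>F y in nhds (f p). y \<in> fst d"
    using d unfolding is_chart_def by (intro eventually_nhds_in_open) auto
  from eventually_compose_filterlim[OF eventually_compose_filterlim[OF this lim_f]
      tendsto_chart_inv[OF c]]
  have eq: "\<forall>\<^sub>F x in nhds (snd c p).
      ((snd e \<circ> g \<circ> chart_inv d) \<circ> (snd d \<circ> f \<circ> chart_inv c)) x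
      = (snd e \<circ> (\<lambda>x. g (f x)) \<circ> chart_inv c) x"
    by eventually_elim (simp add: chart_inv_image[OF d(1)])
  have "twice_differentiable_at
      ((snd e \<circ> g \<circ> chart_inv d) \<circ> (snd d \<circ> f \<circ> chart_inv c)) (snd c p)"
    using diff_f diff_g
    by (intro twice_differentiable_at_compose) (simp_all add: chart_inv_image[OF c])
  then have "twice_differentiable_at (snd e \<circ> (\<lambda>x. g (f x)) \<circ> chart_inv c) (snd c p)"
    using eq by (rule twice_differentiable_at_cong)
  then show ?thesis
    using c e filterlim_compose[OF lim_g lim_f]
    unfolding twice_differentiable_in_charts_def by simp
qed

lemma twice_differentiable_in_charts_Pair:
  assumes f: "twice_differentiable_in_charts c d f p"
    and g: "twice_differentiable_in_charts c e g p"
  shows "twice_differentiable_in_charts c (prod_chart d e) (\<lambda>x. (f x, g x)) p"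
proof -
  note F = f[unfolded twice_differentiable_in_charts_def]
  note G = g[unfolded twice_differentiable_in_charts_def]
  have eq: "snd (prod_chart d e) \<circ> (\<lambda>x. (f x, g x)) \<circ> chart_inv c
    = (\<lambda>x. ((snd d \<circ> f \<circ> chart_inv c) x, (snd e \<circ> g \<circ> chart_inv c) x))"
    by (auto simp: prod_chart_def)
  have "twice_differentiable_at
      (snd (prod_chart d e) \<circ> (\<lambda>x. (f x, g x)) \<circ> chart_inv c) (snd c p)"
    unfolding eq by (rule twice_differentiable_at_Pair) (simp_all only: F G)
  moreover have "filterlim (\<lambda>x. (f x, g x)) (nhds (f p, g p)) (nhds p)"
    using F G by (intro tendsto_Pair) auto
  ultimately show ?thesis
    using F G is_chart_prod_chart[of d e] unfolding twice_differentiable_in_charts_def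
    by (simp add: prod_chart_def)
qed

lemma twice_differentiable_in_charts_fst:
  assumes c: "is_chart c" "p \<in> fst c" and d: "is_chart d" "q \<in> fst d"
  shows "twice_differentiable_in_charts (prod_chart c d) c fst (p, q)"
proof -
  have "\<forall>\<^sub>F z in nhds (snd c p, snd d q). fst z = (snd c \<circ> fst \<circ> chart_inv (prod_chart c d)) z"
  proof -
    have "\<forall>\<^sub>F z in nhds (snd c p, snd d q). snd c (chart_inv c (fst z)) = fst z"
      unfolding nhds_prod
      using eventually_compose_filterlim[OF eventually_chart_inv_in_domain[OF c] filterlim_fst]
      by (rule eventually_mono) simp
    with eventually_chart_inv_prod_chart[OF c(1) d(1) c(2) d(2)] show ?thesis
      by eventually_elim simp
  qed
  then have "twice_differentiable_at (snd c \<circ> fst \<circ> chart_inv (prod_chart c d)) (snd c p, snd d q)"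
    using twice_differentiable_at_bounded_linear[OF bounded_linear_fst]
    by (rule twice_differentiable_at_cong[rotated])
  then show ?thesis
    using c d is_chart_prod_chart[OF c(1) d(1)] tendsto_fst[OF filterlim_ident, of "(p, q)"]
    unfolding twice_differentiable_in_charts_def by (simp add: prod_chart_def)
qed

lemma twice_differentiable_in_charts_snd:
  assumes c: "is_chart c" "p \<in> fst c" and d: "is_chart d" "q \<in> fst d"
  shows "twice_differentiable_in_charts (prod_chart c d) d snd (p, q)"
proof -
  have "\<forall>\<^sub>F z in nhds (snd c p, snd d q). snd z = (snd d \<circ> snd \<circ> chart_inv (prod_chart c d)) z"
  proof -
    have "\<forall>\<^sub>F z in nhds (snd c p, snd d q). snd d (chart_inv d (snd z)) = snd z"
      unfolding nhds_prod
      using eventually_compose_filterlim[OF eventually_chart_inv_in_domain[OF d] filterlim_snd]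
      by (rule eventually_mono) simp
    with eventually_chart_inv_prod_chart[OF c(1) d(1) c(2) d(2)] show ?thesis
      by eventually_elim simp
  qed
  then have "twice_differentiable_at (snd d \<circ> snd \<circ> chart_inv (prod_chart c d)) (snd c p, snd d q)"
    using twice_differentiable_at_bounded_linear[OF bounded_linear_snd]
    by (rule twice_differentiable_at_cong[rotated])
  then show ?thesis
    using c d is_chart_prod_chart[OF c(1) d(1)] tendsto_snd[OF filterlim_ident, of "(p, q)"]
    unfolding twice_differentiable_in_charts_def by (simp add: prod_chart_def)
qed

section \<open>Left-invariant fields and the bracket\<close>

text \<open>With \<open>F(x, y)\<close> the multiplication in coordinates, \<open>P x\<close> is the partial derivative \<open>D\<^sub>2F(x, e)\<close>, so
  \<open>x \<mapsto> P x \<xi>\<close> is the left-invariant field of \<open>\<xi>\<close>. Working with the operator \<open>P x\<close> treats all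
  \<open>\<xi>\<close> on a common neighbourhood of \<open>e\<close>.\<close>

lemma left_invariant_field_derivative:
  fixes c :: "('p::topological_space, 'a::real_normed_vector) chart"
  assumes mult: "twice_differentiable_in_charts (prod_chart c c) c
      (\<lambda>(x, y). x \<otimes>\<^bsub>G\<^esub> y) (\<one>\<^bsub>G\<^esub>, \<one>\<^bsub>G\<^esub>)"
    and c: "is_chart c" "\<one>\<^bsub>G\<^esub> \<in> fst c"
  obtains P :: "'a \<Rightarrow> 'a \<Rightarrow>\<^sub>L 'a"
  where "\<forall>\<^sub>F x in nhds (snd c \<one>\<^bsub>G\<^esub>).
      ((\<lambda>y. snd c (chart_inv c x \<otimes>\<^bsub>G\<^esub> chart_inv c y)) has_derivative blinfun_apply (P x))
        (at (snd c \<one>\<^bsub>G\<^esub>))"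
    and "P differentiable (at (snd c \<one>\<^bsub>G\<^esub>))"
proof -
  define e where "e = snd c \<one>\<^bsub>G\<^esub>"
  define F where "F z = snd c (chart_inv c (fst z) \<otimes>\<^bsub>G\<^esub> chart_inv c (snd z))" for z
  have "twice_differentiable_at (snd c \<circ> (\<lambda>(x, y). x \<otimes>\<^bsub>G\<^esub> y) \<circ> chart_inv (prod_chart c c)) (e, e)"
    using mult unfolding twice_differentiable_in_charts_def by (simp add: e_def prod_chart_def)
  moreover have "\<forall>\<^sub>F z in nhds (e, e).
      (snd c \<circ> (\<lambda>(x, y). x \<otimes>\<^bsub>G\<^esub> y) \<circ> chart_inv (prod_chart c c)) z = F z"
    using eventually_chart_inv_prod_chart[OF c(1) c(1) c(2) c(2)] unfolding e_def
    by eventually_elim (simp add: F_def)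
  ultimately have "twice_differentiable_at F (e, e)"
    by (rule twice_differentiable_at_cong)
  then obtain F' where F': "\<forall>\<^sub>F z in nhds (e, e). (F has_derivative blinfun_apply (F' z)) (at z)"
    "F' differentiable (at (e, e))"
    unfolding twice_differentiable_at_def by blast
  define i where "i = Blinfun (\<lambda>y::'a. (0::'a, y))"
  have i: "blinfun_apply i = (\<lambda>y. (0, y))"
    unfolding i_def by (rule bounded_linear_Blinfun_apply[OF bounded_linear_inr])
  define P where "P x = F' (x, e) o\<^sub>L i" for x
  have dx: "((\<lambda>x. (x, e)) has_derivative (\<lambda>u. (u, 0))) (at x)" for x
    by (auto intro!: derivative_eq_intros)
  have dy: "((\<lambda>y. (x, y)) has_derivative blinfun_apply i) (at y)" for x y
    unfolding i by (auto intro!: derivative_eq_intros)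
  have "filterlim (\<lambda>x. (x, e)) (nhds (e, e)) (nhds e)"
    by (intro tendsto_Pair filterlim_ident tendsto_const)
  with F'(1) have "\<forall>\<^sub>F x in nhds e. (F has_derivative blinfun_apply (F' (x, e))) (at (x, e))"
    by (rule eventually_compose_filterlim)
  then have 1: "\<forall>\<^sub>F x in nhds e.
      ((\<lambda>y. snd c (chart_inv c x \<otimes>\<^bsub>G\<^esub> chart_inv c y)) has_derivative blinfun_apply (P x)) (at e)"
  proof eventually_elim
    case (elim x)
    from diff_chain_at[OF dy elim] show ?case
      by (simp add: o_def F_def P_def blinfun_compose.rep_eq)
  qed
  have "(F' \<circ> (\<lambda>x. (x, e))) differentiable (at e)"
    using F'(2) dx by (intro differentiable_chain_at) (auto intro: differentiableI)
  then obtain D0 where "((\<lambda>x. F' (x, e)) has_derivative D0) (at e)"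
    unfolding differentiable_def o_def by blast
  then have 2: "(P has_derivative (\<lambda>u. D0 u o\<^sub>L i)) (at e)"
    unfolding P_def
    by (rule bounded_linear.has_derivative
        [OF bounded_bilinear.bounded_linear_left[OF bounded_bilinear_blinfun_compose]])
  show thesis
    using that[OF 1[unfolded e_def] differentiableI[OF 2[unfolded e_def]]] .
qed

text \<open>Let \<open>P x = D\<^sub>2F(x, e)\<close> as above and let \<open>D\<close> be the derivative of \<open>P\<close> at \<open>e\<close>. The field of \<open>\<xi>\<close> has the
  derivative \<open>u \<mapsto> D u \<xi>\<close> at \<open>e\<close>. The bracket is \<open>D (P e \<xi>) \<eta> - D (P e \<eta>) \<xi>\<close>, a bounded
  bilinear expression in \<open>\<xi>\<close> and \<open>\<eta>\<close>.\<close>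

lemma
  fixes c :: "('p::topological_space, 'a::real_normed_vector) chart"
  assumes mult: "twice_differentiable_in_charts (prod_chart c c) c
      (\<lambda>(x, y). x \<otimes>\<^bsub>G\<^esub> y) (\<one>\<^bsub>G\<^esub>, \<one>\<^bsub>G\<^esub>)"
    and c: "is_chart c" "\<one>\<^bsub>G\<^esub> \<in> fst c"
  shows left_invariant_field_has_derivative: "(left_invariant_field c G \<xi> has_derivative
      frechet_derivative (left_invariant_field c G \<xi>) (at (snd c \<one>\<^bsub>G\<^esub>))) (at (snd c \<one>\<^bsub>G\<^esub>))"
    and bounded_bilinear_lie_bracket: "bounded_bilinear (lie_bracket c G)"
proof -
  let ?e = "snd c \<one>\<^bsub>G\<^esub>"
  obtain P where P: "\<forall>\<^sub>F x in nhds ?e.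
      ((\<lambda>y. snd c (chart_inv c x \<otimes>\<^bsub>G\<^esub> chart_inv c y)) has_derivative blinfun_apply (P x)) (at ?e)"
    and "P differentiable (at ?e)"
    using left_invariant_field_derivative[OF assms] .
  then obtain D where D: "bounded_linear D" "(P has_derivative D) (at ?e)"
    using has_derivative_bounded_linear unfolding differentiable_def by blast
  have ev: "\<forall>\<^sub>F x in nhds ?e. P x \<xi> = left_invariant_field c G \<xi> x" for \<xi>
    using P unfolding left_invariant_field_def
    by eventually_elim (simp add: frechet_derivative_at[symmetric])
  have der: "(left_invariant_field c G \<xi> has_derivative (\<lambda>u. D u \<xi>)) (at ?e)" for \<xi>
  proof (rule has_derivative_transform_eventually)
    show "((\<lambda>x. P x \<xi>) has_derivative (\<lambda>u. D u \<xi>)) (at ?e)"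
      using D(2) by (rule bounded_linear.has_derivative[OF blinfun.bounded_linear_left])
    show "\<forall>\<^sub>F x in at ?e. P x \<xi> = left_invariant_field c G \<xi> x"
      unfolding eventually_at_filter using ev[of \<xi>] by (rule eventually_mono) simp
    show "P ?e \<xi> = left_invariant_field c G \<xi> ?e"
      using ev by (rule eventually_nhds_x_imp_x)
  qed simp
  show "(left_invariant_field c G \<xi> has_derivative
      frechet_derivative (left_invariant_field c G \<xi>) (at ?e)) (at ?e)"
    using der[of \<xi>] unfolding frechet_derivative_at[OF der, symmetric] .
  have br: "lie_bracket c G = (\<lambda>\<xi> \<eta>. D (P ?e \<xi>) \<eta> - D (P ?e \<eta>) \<xi>)"
    unfolding lie_bracket_def Let_def frechet_derivative_at[OF der, symmetric]
    using eventually_nhds_x_imp_x[OF ev] by simp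
  interpret B: bounded_bilinear "\<lambda>\<xi> \<eta>. D (P ?e \<xi>) \<eta>"
    by (rule bounded_bilinear.comp1[OF bounded_bilinear_blinfun_apply
          bounded_linear_compose[OF D(1) blinfun.bounded_linear_right]])
  show "bounded_bilinear (lie_bracket c G)"
    unfolding br
  proof
    obtain K where K: "\<And>\<xi> \<eta>. norm (D (P ?e \<xi>) \<eta>) \<le> norm \<xi> * norm \<eta> * K"
      using B.bounded by blast
    have "norm (D (P ?e \<xi>) \<eta> - D (P ?e \<eta>) \<xi>) \<le> norm \<xi> * norm \<eta> * (K + K)" for \<xi> \<eta>
      using norm_triangle_ineq4[of "D (P ?e \<xi>) \<eta>" "D (P ?e \<eta>) \<xi>"] K[of \<xi> \<eta>] K[of \<eta> \<xi>]
      by (simp add: algebra_simps)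
    then show "\<exists>K. \<forall>\<xi> \<eta>. norm (D (P ?e \<xi>) \<eta> - D (P ?e \<eta>) \<xi>) \<le> norm \<xi> * norm \<eta> * K"
      by blast
  qed (simp_all add: B.add_left B.add_right B.scaleR_left B.scaleR_right scaleR_diff_right)
qed

lemma lie_bracket_antisym: "lie_bracket c G \<xi> \<eta> = - lie_bracket c G \<eta> \<xi>"
  by (simp add: lie_bracket_def Let_def)

lemma twice_differentiable_in_charts_binary:
  assumes "twice_differentiable_in_charts c d f p" and "twice_differentiable_in_charts c e g p"
    and "twice_differentiable_in_charts (prod_chart d e) k (\<lambda>(x, y). op x y) (f p, g p)"
  shows "twice_differentiable_in_charts c k (\<lambda>x. op (f x) (g x)) p"
  using twice_differentiable_in_charts_compose
    [OF twice_differentiable_in_charts_Pair[OF assms(1,2)] assms(3)]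
  by simp

section \<open>Regularity of the product of the double cross product\<close>

context cocycle_matched_pair
begin

lemma is_chart_M: "c \<in> AM \<Longrightarrow> is_chart c"
  using manifold unfolding smooth_atlas_def by blast

lemma is_chart_H: "c \<in> AH \<Longrightarrow> is_chart c"
  using lie_group unfolding lie_group_def smooth_atlas_def by blast

lemma twice_differentiable_mult_H:
  assumes "cH \<in> AH" and "\<one> \<in> fst cH"
  shows "twice_differentiable_in_charts (prod_chart cH cH) cH (\<lambda>(x, y). x \<otimes> y) (\<one>, \<one>)"
proof (rule smooth_map_imp_twice_differentiable_in_charts)
  have "group H" using lie_group by (simp add: lie_group_def)
  then show "(case (\<one>, \<one>) of (x, y) \<Rightarrow> x \<otimes> y) \<in> fst cH"
    using assms by (simp add: group.is_monoid)
  show "smooth_map (prod_atlas AH AH) AH (\<lambda>(x, y). x \<otimes> y)"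
    using lie_group by (simp add: lie_group_def)
  show "prod_chart cH cH \<in> prod_atlas AH AH" "(\<one>, \<one>) \<in> fst (prod_chart cH cH)"
    using assms by (auto simp: prod_atlas_def prod_chart_def)
qed (use assms in \<open>simp_all add: is_chart_H is_chart_prod_chart\<close>)

text \<open>Every constituent of the product is needed in the given charts only, because each structure map sends
  the base points to base points: \<open>1 \<triangleright> o = o\<close>, \<open>o \<cdot> o = o\<close>, \<open>\<sigma>(1, o) = 1\<close> and \<open>\<gamma>(o, o) = 1\<close>.\<close>

lemma twice_differentiable_mult_double_cross:
  assumes M: "cM \<in> AM" "pt \<in> fst cM" and H: "cH \<in> AH" "\<one> \<in> fst cH"
    and G: "G = cocycle_double_cross_product pt H act \<sigma> \<Phi> \<gamma>"
  shows "twice_differentiable_in_charts (prod_chart (prod_chart cM cH) (prod_chart cM cH))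
    (prod_chart cM cH) (\<lambda>(x, y). x \<otimes>\<^bsub>G\<^esub> y) (\<one>\<^bsub>G\<^esub>, \<one>\<^bsub>G\<^esub>)"
proof -
  let ?C = "prod_chart cM cH"
  let ?e = "((pt, \<one>), (pt, \<one>))"
  note D = twice_differentiable_in_charts_compose
  interpret group H using lie_group by (simp add: lie_group_def)
  have charts: "is_chart cM" "is_chart cH" "is_chart ?C"
    using M H by (simp_all add: is_chart_M is_chart_H is_chart_prod_chart)
  have inC: "(pt, \<one>) \<in> fst ?C" using M H by (simp add: prod_chart_def)
  have left: "twice_differentiable_in_charts (prod_chart ?C ?C) ?C fst ?e"
    and right: "twice_differentiable_in_charts (prod_chart ?C ?C) ?C snd ?e"
    using charts inC by (auto intro: twice_differentiable_in_charts_fst twice_differentiable_in_charts_snd)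
  have pM: "twice_differentiable_in_charts ?C cM fst (pt, \<one>)"
    and pH: "twice_differentiable_in_charts ?C cH snd (pt, \<one>)"
    using charts M H by (auto intro: twice_differentiable_in_charts_fst twice_differentiable_in_charts_snd)
  have m1: "twice_differentiable_in_charts (prod_chart ?C ?C) cM (\<lambda>z. fst (fst z)) ?e"
    and h1: "twice_differentiable_in_charts (prod_chart ?C ?C) cH (\<lambda>z. snd (fst z)) ?e"
    and m2: "twice_differentiable_in_charts (prod_chart ?C ?C) cM (\<lambda>z. fst (snd z)) ?e"
    and h2: "twice_differentiable_in_charts (prod_chart ?C ?C) cH (\<lambda>z. snd (snd z)) ?e"
    using pM pH by (auto intro: D[OF left] D[OF right])
  note smooth = smooth_map_imp_twice_differentiable_in_charts
  have act': "twice_differentiable_in_charts (prod_chart cH cM) cM (\<lambda>(h, m). act h m) (\<one>, pt)"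
    using M H charts
    by (intro smooth[OF smooth_act] is_chart_prod_chart)
      (auto simp: prod_atlas_def act_pt prod_chart_def)
  have \<sigma>': "twice_differentiable_in_charts (prod_chart cH cM) cH (\<lambda>(h, m). \<sigma> h m) (\<one>, pt)"
    using M H charts
    by (intro smooth[OF smooth_sigma] is_chart_prod_chart)
      (auto simp: prod_atlas_def sigma_pt prod_chart_def)
  have \<Phi>': "twice_differentiable_in_charts (prod_chart cM cM) cM (\<lambda>(m, n). \<Phi> m n) (pt, pt)"
    using M H charts
    by (intro smooth[OF smooth_Phi] is_chart_prod_chart)
      (auto simp: prod_atlas_def Phi_unit prod_chart_def)
  have \<gamma>': "twice_differentiable_in_charts (prod_chart cM cM) cH (\<lambda>(m, n). \<gamma> m n) (pt, pt)"
    using M H charts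
    by (intro smooth[OF smooth_gamma] is_chart_prod_chart)
      (auto simp: prod_atlas_def gamma_unit prod_chart_def)
  note mult' = twice_differentiable_mult_H[OF H]
  note bin = twice_differentiable_in_charts_binary
  have a: "twice_differentiable_in_charts (prod_chart ?C ?C) cM
      (\<lambda>z. act (snd (fst z)) (fst (snd z))) ?e"
    by (rule bin[OF h1 m2]) (simp add: act')
  have s: "twice_differentiable_in_charts (prod_chart ?C ?C) cH
      (\<lambda>z. \<sigma> (snd (fst z)) (fst (snd z))) ?e"
    by (rule bin[OF h1 m2]) (simp add: \<sigma>')
  have f: "twice_differentiable_in_charts (prod_chart ?C ?C) cM
      (\<lambda>z. \<Phi> (fst (fst z)) (act (snd (fst z)) (fst (snd z)))) ?e"
    by (rule bin[OF m1 a]) (simp add: \<Phi>' act_pt)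
  have g: "twice_differentiable_in_charts (prod_chart ?C ?C) cH
      (\<lambda>z. \<gamma> (fst (fst z)) (act (snd (fst z)) (fst (snd z)))) ?e"
    by (rule bin[OF m1 a]) (simp add: \<gamma>' act_pt)
  have gs: "twice_differentiable_in_charts (prod_chart ?C ?C) cH
      (\<lambda>z. \<gamma> (fst (fst z)) (act (snd (fst z)) (fst (snd z))) \<otimes> \<sigma> (snd (fst z)) (fst (snd z))) ?e"
    by (rule bin[OF g s]) (simp add: mult' act_pt gamma_unit sigma_pt)
  have gsh: "twice_differentiable_in_charts (prod_chart ?C ?C) cH
      (\<lambda>z. \<gamma> (fst (fst z)) (act (snd (fst z)) (fst (snd z))) \<otimes> \<sigma> (snd (fst z)) (fst (snd z))
        \<otimes> snd (snd z)) ?e"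
    by (rule bin[OF gs h2]) (simp add: mult' act_pt gamma_unit sigma_pt)
  have "(\<lambda>(x, y). x \<otimes>\<^bsub>G\<^esub> y) = (\<lambda>z. (\<Phi> (fst (fst z)) (act (snd (fst z)) (fst (snd z))),
      \<gamma> (fst (fst z)) (act (snd (fst z)) (fst (snd z))) \<otimes> \<sigma> (snd (fst z)) (fst (snd z))
        \<otimes> snd (snd z)))"
    by (auto simp: G cocycle_double_cross_product_def)
  moreover have "\<one>\<^bsub>G\<^esub> = (pt, \<one>)"
    by (simp add: G cocycle_double_cross_product_def)
  ultimately show ?thesis
    using twice_differentiable_in_charts_Pair[OF f gsh] by simp
qed

text \<open>By \<open>h \<triangleright> o = o\<close>, \<open>m \<cdot> o = m\<close>, \<open>\<gamma>(m, o) = 1\<close> and \<open>\<sigma>(h, o) = h\<close> one has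
  \<open>(m, h)(o, k) = (m, h * k)\<close>. Hence restricting the coordinate expression of left translation by
  \<open>(m, h)\<close> to \<open>{o} \<times> H\<close> gives a constant and left translation by \<open>h\<close>. The chain rule along
  \<open>k \<mapsto> (o, k)\<close> then identifies the two left-invariant fields.\<close>

lemma left_invariant_field_on_H:
  assumes M: "cM \<in> AM" "pt \<in> fst cM" and H: "cH \<in> AH" "\<one> \<in> fst cH"
    and G: "G = cocycle_double_cross_product pt H act \<sigma> \<Phi> \<gamma>"
  shows "\<forall>\<^sub>F x in nhds (snd (prod_chart cM cH) \<one>\<^bsub>G\<^esub>).
    left_invariant_field (prod_chart cM cH) G (0, \<eta>) x
      = (0, left_invariant_field cH H \<eta> (snd x))"
proof -
  interpret group H using lie_group by (simp add: lie_group_def)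
  have carrier: "h \<in> carrier H" for h using lie_group by (simp add: lie_group_def)
  let ?C = "prod_chart cM cH" and ?m = "snd cM pt" and ?h = "snd cH \<one>"
  have cM: "is_chart cM" and cH: "is_chart cH" and C: "is_chart ?C"
    using M H by (simp_all add: is_chart_M is_chart_H is_chart_prod_chart)
  have oneG: "\<one>\<^bsub>G\<^esub> = (pt, \<one>)"
    by (simp add: G cocycle_double_cross_product_def)
  have inC: "\<one>\<^bsub>G\<^esub> \<in> fst ?C" using M H by (simp add: prod_chart_def oneG)
  have e: "snd ?C \<one>\<^bsub>G\<^esub> = (?m, ?h)" by (simp add: prod_chart_def oneG)
  obtain P where P: "\<forall>\<^sub>F x in nhds (?m, ?h).
      ((\<lambda>y. snd ?C (chart_inv ?C x \<otimes>\<^bsub>G\<^esub> chart_inv ?C y)) has_derivative blinfun_apply (P x))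
        (at (?m, ?h))"
    by (rule left_invariant_field_derivative
        [OF twice_differentiable_mult_double_cross[OF M H G] C inC, unfolded e]) (rule that)
  obtain PH where PH: "\<forall>\<^sub>F x in nhds ?h.
      ((\<lambda>y. snd cH (chart_inv cH x \<otimes> chart_inv cH y)) has_derivative blinfun_apply (PH x))
        (at ?h)"
    by (rule left_invariant_field_derivative
        [OF twice_differentiable_mult_H[OF H] cH H(2)]) (rule that)
  have PH': "\<forall>\<^sub>F x in nhds (?m, ?h). ((\<lambda>y. snd cH (chart_inv cH (snd x) \<otimes> chart_inv cH y))
      has_derivative blinfun_apply (PH (snd x))) (at ?h)"
    unfolding nhds_prod using eventually_compose_filterlim[OF PH filterlim_snd] .
  have split: "\<forall>\<^sub>F x in nhds (?m, ?h).
      chart_inv ?C x = (chart_inv cM (fst x), chart_inv cH (snd x))"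
    using eventually_chart_inv_prod_chart[OF cM cH M(2) H(2)] .
  have "filterlim (\<lambda>y. (?m, y)) (nhds (?m, ?h)) (nhds ?h)"
    by (intro tendsto_Pair filterlim_ident tendsto_const)
  from eventually_compose_filterlim[OF split this]
  have split2: "\<forall>\<^sub>F y in nhds ?h. chart_inv ?C (?m, y) = (pt, chart_inv cH y)"
    by (simp add: chart_inv_image[OF cM M(2)])
  from P PH' split show ?thesis
    unfolding e
  proof eventually_elim
    case (elim x)
    let ?F = "\<lambda>y. snd ?C (chart_inv ?C x \<otimes>\<^bsub>G\<^esub> chart_inv ?C y)"
    let ?FH = "\<lambda>y. snd cH (chart_inv cH (snd x) \<otimes> chart_inv cH y)"
    have eq: "\<forall>\<^sub>F y in nhds ?h. (?F \<circ> (\<lambda>y. (?m, y))) y = (snd cM (chart_inv cM (fst x)), ?FH y)"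
      using split2
    proof eventually_elim
      case (elim y)
      then show ?case
        using \<open>chart_inv ?C x = _\<close> carrier
        by (simp add: G cocycle_double_cross_product_def prod_chart_def act_pt Phi_unit gamma_unit
            sigma_pt)
    qed
    \<comment> \<open>The derivative of the same map is computed twice, by the chain rule and by components.\<close>
    have "((\<lambda>y. (?m, y)) has_derivative (\<lambda>\<eta>. (0, \<eta>))) (at ?h)"
      by (auto intro!: derivative_eq_intros)
    then have "((?F \<circ> (\<lambda>y. (?m, y))) has_derivative (blinfun_apply (P x) \<circ> (\<lambda>\<eta>. (0, \<eta>)))) (at ?h)"
      using elim(1) by (rule diff_chain_at)
    moreover have "((?F \<circ> (\<lambda>y. (?m, y))) has_derivative (\<lambda>\<eta>. (0, PH (snd x) \<eta>))) (at ?h)"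
    proof (rule has_derivative_transform_eventually)
      show "((\<lambda>y. (snd cM (chart_inv cM (fst x)), ?FH y)) has_derivative (\<lambda>\<eta>. (0, PH (snd x) \<eta>))) (at ?h)"
        using elim(2) by (intro has_derivative_Pair has_derivative_const)
      show "\<forall>\<^sub>F y in at ?h. (snd cM (chart_inv cM (fst x)), ?FH y) = (?F \<circ> (\<lambda>y. (?m, y))) y"
        unfolding eventually_at_filter using eq by (rule eventually_mono) simp
      show "(snd cM (chart_inv cM (fst x)), ?FH ?h) = (?F \<circ> (\<lambda>y. (?m, y))) ?h"
        using eventually_nhds_x_imp_x[OF eq] by simp
    qed simp
    ultimately have "blinfun_apply (P x) \<circ> (\<lambda>\<eta>. (0, \<eta>)) = (\<lambda>\<eta>. (0, PH (snd x) \<eta>))"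
      by (rule has_derivative_unique)
    from fun_cong[OF this, of \<eta>] show ?case
      unfolding left_invariant_field_def e frechet_derivative_at[OF elim(1), symmetric]
        frechet_derivative_at[OF elim(2), symmetric] by simp
  qed
qed

text \<open>Near the identity the fields of \<open>(0, \<eta>)\<close> and \<open>(0, \<zeta>)\<close> depend on the \<open>H\<close>-coordinate only and have no component along
  \<open>M\<close>, so their commutator is the one computed on \<open>H\<close>.\<close>

lemma lie_bracket_on_H:
  assumes M: "cM \<in> AM" "pt \<in> fst cM" and H: "cH \<in> AH" "\<one> \<in> fst cH"
    and G: "G = cocycle_double_cross_product pt H act \<sigma> \<Phi> \<gamma>"
  shows "lie_bracket (prod_chart cM cH) G (0, \<eta>) (0, \<zeta>) = (0, lie_bracket cH H \<eta> \<zeta>)"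
proof -
  let ?C = "prod_chart cM cH"
  have e: "snd ?C \<one>\<^bsub>G\<^esub> = (snd cM pt, snd cH \<one>)"
    by (simp add: prod_chart_def G cocycle_double_cross_product_def)
  let ?X = "left_invariant_field ?C G" and ?XH = "left_invariant_field cH H"
  let ?D = "\<lambda>\<xi>. frechet_derivative (?XH \<xi>) (at (snd cH \<one>))"
  note ev = left_invariant_field_on_H[OF M H G, unfolded e]
  have der: "(?X (0, \<xi>) has_derivative (\<lambda>u. (0, ?D \<xi> (snd u)))) (at (snd cM pt, snd cH \<one>))" for \<xi>
  proof (rule has_derivative_transform_eventually)
    have "(?XH \<xi> has_derivative ?D \<xi>) (at (snd (snd cM pt, snd cH \<one>)))"
      using left_invariant_field_has_derivative[OF twice_differentiable_mult_H[OF H] is_chart_H[OF H(1)] H(2)]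
      by simp
    from diff_chain_at[OF bounded_linear_imp_has_derivative[OF bounded_linear_snd] this]
    show "((\<lambda>x. (0, ?XH \<xi> (snd x))) has_derivative (\<lambda>u. (0, ?D \<xi> (snd u)))) (at (snd cM pt, snd cH \<one>))"
      by (intro has_derivative_Pair has_derivative_const) (simp add: o_def)
    show "\<forall>\<^sub>F x in at (snd cM pt, snd cH \<one>). (0, ?XH \<xi> (snd x)) = ?X (0, \<xi>) x"
      unfolding eventually_at_filter using ev[of \<xi>] by (rule eventually_mono) simp
    show "(0, ?XH \<xi> (snd (snd cM pt, snd cH \<one>))) = ?X (0, \<xi>) (snd cM pt, snd cH \<one>)"
      using eventually_nhds_x_imp_x[OF ev[of \<xi>]] by simp
  qed simp
  show ?thesis
    unfolding lie_bracket_def Let_def e frechet_derivative_at[OF der, symmetric]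
    using eventually_nhds_x_imp_x[OF ev] by simp
qed

end

section \<open>Functional derivatives and the dual of a direct sum\<close>

lemma blinfun_separates_points:
  fixes x y :: "'a::real_inner"
  assumes "\<And>\<nu> :: 'a \<Rightarrow>\<^sub>L real. \<nu> x = \<nu> y"
  shows "x = y"
proof -
  have "(x - y) \<bullet> (x - y) = 0"
    using assms[of "blinfun_inner_left (x - y)"] by (simp add: inner_diff_left)
  then show ?thesis by simp
qed

text \<open>In an orthonormal basis \<open>\<nu> = \<Sum>b. \<nu>(b) (_ \<bullet> b)\<close>, which exhibits the representing vector as
  \<open>\<Sum>b. L(_ \<bullet> b) b\<close>.\<close>

lemma bidual_representation:
  fixes L :: "('a::finite_dim_inner \<Rightarrow>\<^sub>L real) \<Rightarrow> real"
  assumes "linear L"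
  obtains x where "\<And>\<nu>. L \<nu> = blinfun_apply \<nu> x"
proof -
  interpret L: linear L by fact
  obtain B :: "'a set" where B: "finite B" "\<And>x. x = (\<Sum>b\<in>B. (x \<bullet> b) *\<^sub>R b)"
    using orthonormal_basis_exists by blast
  have "L \<nu> = blinfun_apply \<nu> (\<Sum>b\<in>B. L (blinfun_inner_left b) *\<^sub>R b)" for \<nu>
  proof -
    have "\<nu> = (\<Sum>b\<in>B. \<nu> b *\<^sub>R blinfun_inner_left b)"
    proof (rule blinfun_eqI)
      fix x
      have "\<nu> x = \<nu> (\<Sum>b\<in>B. (x \<bullet> b) *\<^sub>R b)" using B(2)[of x] by simp
      then show "\<nu> x = (\<Sum>b\<in>B. \<nu> b *\<^sub>R blinfun_inner_left b) x"
        by (simp add: blinfun.sum_left blinfun.sum_right blinfun.scaleR_left blinfun.scaleR_right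
            mult.commute)
    qed
    then have "L \<nu> = L (\<Sum>b\<in>B. \<nu> b *\<^sub>R blinfun_inner_left b)" by simp
    then show ?thesis
      by (simp add: L.sum L.scaleR blinfun.sum_right blinfun.scaleR_right mult.commute)
  qed
  then show thesis using that by blast
qed

lemma functional_derivative_eqI:
  fixes F :: "('a::real_inner \<Rightarrow>\<^sub>L real) \<Rightarrow> real"
  assumes "(F has_derivative (\<lambda>\<nu>. blinfun_apply \<nu> x)) (at \<mu>)"
  shows "functional_derivative F \<mu> = x"
  unfolding functional_derivative_def
proof (rule the_equality)
  show "(F has_derivative (\<lambda>\<nu>. blinfun_apply \<nu> x)) (at \<mu>)" by fact
next
  fix y assume y: "(F has_derivative (\<lambda>\<nu>. blinfun_apply \<nu> y)) (at \<mu>)"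
  have "(\<lambda>\<nu> :: 'a \<Rightarrow>\<^sub>L real. blinfun_apply \<nu> y) = (\<lambda>\<nu>. blinfun_apply \<nu> x)"
    by (rule has_derivative_unique[OF y assms])
  from fun_cong[OF this] show "y = x" by (rule blinfun_separates_points)
qed

text \<open>The functional derivative is defined by a definite description; existence comes from reflexivity of
  finite-dimensional spaces.\<close>

lemma functional_derivative_has_derivative:
  fixes F :: "('a::finite_dim_inner \<Rightarrow>\<^sub>L real) \<Rightarrow> real"
  assumes "(F has_derivative L) (at \<mu>)"
  shows "L \<nu> = blinfun_apply \<nu> (functional_derivative F \<mu>)"
proof -
  obtain x where x: "\<And>\<nu>. L \<nu> = blinfun_apply \<nu> x"
    using bidual_representation[OF has_derivative_linear[OF assms]] by blast
  then have "L = (\<lambda>\<nu>. blinfun_apply \<nu> x)" by blast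
  then have "functional_derivative F \<mu> = x"
    using assms by (intro functional_derivative_eqI) simp
  then show ?thesis by (simp add: x)
qed

lemma transpose_map_apply:
  assumes "bounded_linear f"
  shows "blinfun_apply (transpose_map f \<alpha>) x = \<alpha> (f x)"
  unfolding transpose_map_def
  using bounded_linear_compose[OF blinfun.bounded_linear_right[of \<alpha>] assms]
  by (simp add: bounded_linear_Blinfun_apply)

lemma coad_apply:
  assumes "bounded_linear (br \<xi>)"
  shows "blinfun_apply (coad br \<xi> \<mu>) \<zeta> = - \<mu> (br \<xi> \<zeta>)"
  unfolding coad_def
  using bounded_linear_minus[OF bounded_linear_compose[OF blinfun.bounded_linear_right[of \<mu>] assms]]
  by (simp add: bounded_linear_Blinfun_apply)

lemma dual_split_apply:
  "blinfun_apply (fst (dual_split \<mu>)) v = \<mu> (v, 0)"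
  "blinfun_apply (snd (dual_split \<mu>)) \<eta> = \<mu> (0, \<eta>)"
  by (simp_all add: dual_split_def transpose_map_apply bounded_linear_inl bounded_linear_inr)

lemma dual_split_sum:
  "blinfun_apply \<mu> (v, \<eta>) = fst (dual_split \<mu>) v + snd (dual_split \<mu>) \<eta>"
  using blinfun.add_right[of \<mu> "(v, 0)" "(0, \<eta>)"] by (simp add: dual_split_apply)

text \<open>The inverse of \<^const>\<open>dual_split\<close>; its continuity makes differentiability of a curve in the dual
  equivalent to differentiability of its two components.\<close>

definition dual_join ::
  "('v::real_normed_vector \<Rightarrow>\<^sub>L real) \<times> ('g::real_normed_vector \<Rightarrow>\<^sub>L real) \<Rightarrow> ('v \<times> 'g) \<Rightarrow>\<^sub>L real"
  where "dual_join p = (fst p o\<^sub>L fst_blinfun) + (snd p o\<^sub>L snd_blinfun)"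

lemma dual_join_dual_split: "dual_join (dual_split \<mu>) = \<mu>"
  by (rule blinfun_eqI)
    (auto simp: dual_join_def blinfun.add_left fst_blinfun.rep_eq snd_blinfun.rep_eq dual_split_sum)

lemma bounded_linear_dual_join: "bounded_linear dual_join"
  unfolding dual_join_def
  by (intro bounded_linear_add
      bounded_linear_compose[OF bounded_bilinear.bounded_linear_left[OF bounded_bilinear_blinfun_compose]]
      bounded_linear_fst bounded_linear_snd)

lemma bounded_linear_dual_split: "bounded_linear dual_split"
proof -
  have eq: "dual_split = (\<lambda>\<mu>. (\<mu> o\<^sub>L Blinfun (\<lambda>v. (v, 0)), \<mu> o\<^sub>L Blinfun (\<lambda>\<eta>. (0, \<eta>))))"
    by (auto simp: dual_split_def transpose_map_apply bounded_linear_inl bounded_linear_inr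
        bounded_linear_Blinfun_apply intro!: ext blinfun_eqI)
  show ?thesis
    unfolding eq
    by (intro bounded_linear_Pair
        bounded_bilinear.bounded_linear_left[OF bounded_bilinear_blinfun_compose])
qed

lemma has_vector_derivative_dual_split_iff:
  "(\<mu> has_vector_derivative \<mu>') (at t within T) \<longleftrightarrow>
    ((\<lambda>s. fst (dual_split (\<mu> s))) has_vector_derivative fst (dual_split \<mu>')) (at t within T) \<and>
    ((\<lambda>s. snd (dual_split (\<mu> s))) has_vector_derivative snd (dual_split \<mu>')) (at t within T)"
  (is "?L \<longleftrightarrow> ?R")
proof
  assume ?L
  from bounded_linear.has_vector_derivative[OF bounded_linear_dual_split this]
  show ?R
    using bounded_linear.has_vector_derivative[OF bounded_linear_fst]
      bounded_linear.has_vector_derivative[OF bounded_linear_snd] by blast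
next
  assume R: ?R
  from bounded_linear.has_vector_derivative
    [OF bounded_linear_dual_join has_vector_derivative_Pair[OF conjunct1[OF R] conjunct2[OF R]]]
  show ?L by (simp add: dual_join_dual_split)
qed

text \<open>The differential of \<open>Ham\<close> is the sum of its two partial differentials, each of which is evaluation at a
  partial functional derivative.\<close>

lemma functional_derivative_dual_split:
  fixes Ham :: "('v::finite_dim_inner \<Rightarrow>\<^sub>L real) \<times> ('g::finite_dim_inner \<Rightarrow>\<^sub>L real) \<Rightarrow> real"
  assumes "Ham differentiable (at (\<kappa>, lam))" and \<mu>: "dual_split \<mu> = (\<kappa>, lam)"
  shows "functional_derivative (\<lambda>\<nu>. Ham (dual_split \<nu>)) \<mu> =
    (functional_derivative (\<lambda>\<alpha>. Ham (\<alpha>, lam)) \<kappa>, functional_derivative (\<lambda>\<beta>. Ham (\<kappa>, \<beta>)) lam)"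
    (is "_ = (?d\<kappa>, ?dlam)")
proof (rule functional_derivative_eqI)
  obtain L where L: "(Ham has_derivative L) (at (\<kappa>, lam))"
    using assms(1) unfolding differentiable_def by blast
  interpret L: bounded_linear L using L by (rule has_derivative_bounded_linear)
  have "((\<lambda>\<alpha>. (\<alpha>, lam)) has_derivative (\<lambda>\<alpha>. (\<alpha>, 0))) (at \<kappa>)"
    by (auto intro!: derivative_eq_intros)
  from diff_chain_at[OF this L] have 1: "L (\<alpha>, 0) = \<alpha> ?d\<kappa>" for \<alpha>
    using functional_derivative_has_derivative[of "\<lambda>\<alpha>. Ham (\<alpha>, lam)" "\<lambda>\<alpha>. L (\<alpha>, 0)"]
    by (simp add: o_def)
  have "((\<lambda>\<beta>. (\<kappa>, \<beta>)) has_derivative (\<lambda>\<beta>. (0, \<beta>))) (at lam)"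
    by (auto intro!: derivative_eq_intros)
  from diff_chain_at[OF this L] have 2: "L (0, \<beta>) = \<beta> ?dlam" for \<beta>
    using functional_derivative_has_derivative[of "\<lambda>\<beta>. Ham (\<kappa>, \<beta>)" "\<lambda>\<beta>. L (0, \<beta>)"]
    by (simp add: o_def)
  have "L (dual_split \<nu>) = blinfun_apply \<nu> (?d\<kappa>, ?dlam)" for \<nu>
    using L.add[of "(fst (dual_split \<nu>), 0)" "(0, snd (dual_split \<nu>))"]
    by (simp add: 1 2 dual_split_sum)
  moreover have "((\<lambda>\<nu>. Ham (dual_split \<nu>)) has_derivative (\<lambda>\<nu>. L (dual_split \<nu>))) (at \<mu>)"
    using diff_chain_at[OF bounded_linear_imp_has_derivative[OF bounded_linear_dual_split], of Ham L \<mu>] L \<mu>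
    by (simp add: o_def)
  ultimately show "((\<lambda>\<nu>. Ham (dual_split \<nu>)) has_derivative
      (\<lambda>\<nu>. blinfun_apply \<nu> (?d\<kappa>, ?dlam))) (at \<mu>)"
    by simp
qed

section \<open>The Lie-Poisson equations\<close>

text \<open>Evaluation of \<open>- \<langle>\<mu>, [(v, \<eta>), _]\<rangle>\<close> on \<open>(w, 0)\<close> and on \<open>(0, \<zeta>)\<close>. In the second case
  antisymmetry turns \<open>[(v, 0), (0, \<zeta>)]\<close> around, which accounts for the signs of the two transposes in the
  \<open>\<hh>\<close>-component.\<close>

lemma dual_split_coad:
  fixes br :: "'v::real_normed_vector \<times> 'g::real_normed_vector \<Rightarrow> 'v \<times> 'g \<Rightarrow> 'v \<times> 'g"
  assumes br: "bounded_bilinear br" and antisym: "\<And>x y. br x y = - br y x"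
    and subalgebra: "\<And>\<eta> \<zeta>. br (0, \<eta>) (0, \<zeta>) = (0, brH \<eta> \<zeta>)"
    and \<mu>: "dual_split \<mu> = (\<kappa>, lam)"
  shows "dual_split (coad br (v, \<eta>) \<mu>) =
    (coad (inf_bracket br) v \<kappa> - transpose_map (inf_act br \<eta>) \<kappa>
      - transpose_map (inf_psi br \<eta>) lam - transpose_map (inf_theta br v) lam,
     coad brH \<eta> lam + transpose_map (\<lambda>\<zeta>. inf_act br \<zeta> v) \<kappa>
      + transpose_map (\<lambda>\<zeta>. inf_psi br \<zeta> v) lam)"
proof -
  interpret br: bounded_bilinear br by fact
  have mu: "\<mu> z = \<kappa> (fst z) + lam (snd z)" for z
    using dual_split_sum[of \<mu> "fst z" "snd z"] \<mu> by simp
  have right: "bounded_linear (\<lambda>w. fst (br x (w, 0)))" "bounded_linear (\<lambda>w. snd (br x (w, 0)))"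
    "bounded_linear (\<lambda>\<zeta>. snd (br x (0, \<zeta>)))" for x
    by (intro bounded_linear_compose[OF bounded_linear_fst]
        bounded_linear_compose[OF bounded_linear_snd]
        bounded_linear_compose[OF br.bounded_linear_right] bounded_linear_inl bounded_linear_inr)+
  have left: "bounded_linear (\<lambda>\<zeta>. fst (br (0, \<zeta>) x))" "bounded_linear (\<lambda>\<zeta>. snd (br (0, \<zeta>) x))" for x
    by (intro bounded_linear_compose[OF bounded_linear_fst]
        bounded_linear_compose[OF bounded_linear_snd]
        bounded_linear_compose[OF br.bounded_linear_left] bounded_linear_inr)+
  \<comment> \<open>The transpose and the coadjoint action are meaningful values only for bounded linear maps.\<close>
  have bl: "bounded_linear (inf_bracket br v)" "bounded_linear (inf_theta br v)"
    "bounded_linear (inf_act br \<eta>)" "bounded_linear (inf_psi br \<eta>)" "bounded_linear (brH \<eta>)"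
    "bounded_linear (\<lambda>\<zeta>. inf_act br \<zeta> v)" "bounded_linear (\<lambda>\<zeta>. inf_psi br \<zeta> v)"
    using right(1)[of "(v, 0)"] right(2)[of "(v, 0)"] right(1)[of "(0, \<eta>)"] right(2)[of "(0, \<eta>)"]
      right(3)[of "(0, \<eta>)"] left[of "(v, 0)"]
    unfolding inf_bracket_def inf_theta_def inf_act_def inf_psi_def by (simp_all add: subalgebra)
  have sum: "br (v, \<eta>) z = br (v, 0) z + br (0, \<eta>) z" for z
    using br.add_left[of "(v, 0)" "(0, \<eta>)"] by simp
  show ?thesis
  proof (rule prod_eqI; rule blinfun_eqI)
    fix w
    show "blinfun_apply (fst (dual_split (coad br (v, \<eta>) \<mu>))) w = fst
      (coad (inf_bracket br) v \<kappa> - transpose_map (inf_act br \<eta>) \<kappa>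
        - transpose_map (inf_psi br \<eta>) lam - transpose_map (inf_theta br v) lam,
       coad brH \<eta> lam + transpose_map (\<lambda>\<zeta>. inf_act br \<zeta> v) \<kappa>
        + transpose_map (\<lambda>\<zeta>. inf_psi br \<zeta> v) lam) w"
      by (simp add: dual_split_apply coad_apply br.bounded_linear_right sum mu bl
          transpose_map_apply blinfun.diff_left blinfun.add_right)
        (simp add: inf_bracket_def inf_theta_def inf_act_def inf_psi_def)
  next
    fix \<zeta>
    show "blinfun_apply (snd (dual_split (coad br (v, \<eta>) \<mu>))) \<zeta> = snd
      (coad (inf_bracket br) v \<kappa> - transpose_map (inf_act br \<eta>) \<kappa>
        - transpose_map (inf_psi br \<eta>) lam - transpose_map (inf_theta br v) lam,
       coad brH \<eta> lam + transpose_map (\<lambda>\<zeta>. inf_act br \<zeta> v) \<kappa>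
        + transpose_map (\<lambda>\<zeta>. inf_psi br \<zeta> v) lam) \<zeta>"
      by (simp add: dual_split_apply coad_apply br.bounded_linear_right sum mu bl subalgebra
          antisym[of "(v, 0)"] transpose_map_apply blinfun.add_left blinfun.add_right blinfun.minus_right)
        (simp add: inf_act_def inf_psi_def blinfun.diff_right)
  qed
qed

theorem corollary4p3:
  fixes AM :: "('m::{t2_space, second_countable_topology}, 'v::finite_dim_inner) chart set"
    and pt :: 'm
    and AH :: "('h::{t2_space, second_countable_topology}, 'g::finite_dim_inner) chart set"
    and H :: "'h monoid"
    and act :: "'h \<Rightarrow> 'm \<Rightarrow> 'm"
    and \<sigma> :: "'h \<Rightarrow> 'm \<Rightarrow> 'h"
    and \<Phi> :: "'m \<Rightarrow> 'm \<Rightarrow> 'm"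
    and \<gamma> :: "'m \<Rightarrow> 'm \<Rightarrow> 'h"
    and cM :: "('m, 'v) chart" and cH :: "('h, 'g) chart"
    and Ham :: "('v \<Rightarrow>\<^sub>L real) \<times> ('g \<Rightarrow>\<^sub>L real) \<Rightarrow> real"
    and \<mu> :: "real \<Rightarrow> (('v \<times> 'g) \<Rightarrow>\<^sub>L real)"
    and \<kappa> :: "real \<Rightarrow> ('v \<Rightarrow>\<^sub>L real)"
    and lam :: "real \<Rightarrow> ('g \<Rightarrow>\<^sub>L real)"
    and T :: "real set" and t :: real
    and G :: "('m \<times> 'h) monoid"
    and br :: "'v \<times> 'g \<Rightarrow> 'v \<times> 'g \<Rightarrow> 'v \<times> 'g"
    and d\<kappa> :: 'v and dlam :: 'g
  assumes "cocycle_matched_pair AM pt AH H act \<sigma> \<Phi> \<gamma>"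
    and "cM \<in> AM" "pt \<in> fst cM"
    and "cH \<in> AH" "\<one>\<^bsub>H\<^esub> \<in> fst cH"
    and "G = cocycle_double_cross_product pt H act \<sigma> \<Phi> \<gamma>"
    and "br = lie_bracket (prod_chart cM cH) G"
    and "\<forall>\<nu>. Ham differentiable (at \<nu>)"
    and "\<forall>s. dual_split (\<mu> s) = (\<kappa> s, lam s)"
    and "d\<kappa> = functional_derivative (\<lambda>\<alpha>. Ham (\<alpha>, lam t)) (\<kappa> t)"
    and "dlam = functional_derivative (\<lambda>\<beta>. Ham (\<kappa> t, \<beta>)) (lam t)"
  shows "(\<mu> has_vector_derivative lie_poisson_field br (\<lambda>\<nu>. Ham (dual_split \<nu>)) (\<mu> t)) (at t within T)
    \<longleftrightarrow>
      (\<kappa> has_vector_derivative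
          coad (inf_bracket br) d\<kappa> (\<kappa> t)
        - transpose_map (inf_act br dlam) (\<kappa> t)
        - transpose_map (inf_psi br dlam) (lam t)
        - transpose_map (inf_theta br d\<kappa>) (lam t)) (at t within T) \<and>
      (lam has_vector_derivative
          coad (lie_bracket cH H) dlam (lam t)
        + transpose_map (\<lambda>\<eta>. inf_act br \<eta> d\<kappa>) (\<kappa> t)
        + transpose_map (\<lambda>\<eta>. inf_psi br \<eta> d\<kappa>) (lam t)) (at t within T)"
proof -
  interpret cocycle_matched_pair AM pt AH H act \<sigma> \<Phi> \<gamma> by fact
  let ?C = "prod_chart cM cH"
  have C: "is_chart ?C" "\<one>\<^bsub>G\<^esub> \<in> fst ?C"
    using assms(2-6) is_chart_prod_chart[OF is_chart_M is_chart_H]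
    by (simp_all add: prod_chart_def cocycle_double_cross_product_def)
  have br: "bounded_bilinear br"
    unfolding assms(7)
    by (rule bounded_bilinear_lie_bracket
        [OF twice_differentiable_mult_double_cross[OF assms(2-6)] C])
  have antisym: "br x y = - br y x" for x y
    unfolding assms(7) by (rule lie_bracket_antisym)
  have subalgebra: "br (0, \<eta>) (0, \<zeta>) = (0, lie_bracket cH H \<eta> \<zeta>)" for \<eta> \<zeta>
    unfolding assms(7) by (rule lie_bracket_on_H[OF assms(2-6)])
  have \<mu>: "dual_split (\<mu> s) = (\<kappa> s, lam s)" for s
    using assms(9) by blast
  have "functional_derivative (\<lambda>\<nu>. Ham (dual_split \<nu>)) (\<mu> t) = (d\<kappa>, dlam)"
    unfolding assms(10,11) by (rule functional_derivative_dual_split) (use assms(8) \<mu> in auto)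
  then show ?thesis
    unfolding has_vector_derivative_dual_split_iff lie_poisson_field_def
    by (simp only: dual_split_coad[OF br antisym subalgebra \<mu>] \<mu> fst_conv snd_conv)
qed

end
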